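(* Let $A_\bullet$ be a quadratic algebra over an arbitrary field $\Bbbk$, and suppose that the component $A_1$ admits a decomposition as a direct sum of vector spaces $A_1=U\oplus W$ such that: (i) $U\cdot W:=\mathrm{Span}_{\Bbbk}\{u\cdot w\mid u\in U,\ w\in W\}=A_2$; (ii) $U\cdot U:=\mathrm{Span}_{\Bbbk}\{u\cdot u'\mid u,u'\in U\}=0$. Then the algebra $A_\bullet$ is Koszul.
   Context: All graded algebras $A_\bullet=\bigoplus_{n\ge0}A_n$ over a field $\Bbbk$ are unitary, associative, connected ($A_0=\Bbbk$), non-negatively graded and of finite type ($\dim A_n<\infty$ for all $n$). $A_\bullet$ is quadratic if $A_\bullet\cong \mathbf{T}_\bullet(V)/(\Omega)$ as graded algebras, with $V=A_1$, $\mathbf{T}_\bullet(V)=\bigoplus_{n\geq0}V^{\otimes n}$ the tensor algebra, and $(\Omega)$ the two-sided ideal generated by some subspace $\Omega\subseteq V\otimes V$. A quadratic algebra $A_\bullet$ is Koszul if the trivial module $\Bbbk$ has a resolution $\cdots\to P(2)_\bullet\to P(1)_\bullet\to P(0)_\bullet\to\Bbbk$ by free graded right $A_\bullet$-modules (with degree-preserving maps) such that, for each $n\ge0$, $P(n)_n$ is finite-dimensional over $\Bbbk$ and generates $P(n)_\bullet$ as a graded $A_\bullet$-module; equivalently $\mathrm{Ext}^{i,j}_{A_\bullet}(\Bbbk,\Bbbk)=0$ for $i\ne j$. *)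

theory Defs
  imports Complex_Main "HOL-Algebra.QuotRing" "HOL-Library.Poly_Mapping"
begin

section \<open>Internal direct sums\<close>

definition direct_sum :: "(nat \<Rightarrow> 'm::comm_monoid_add set) \<Rightarrow> 'm set"
  where "direct_sum C = {\<Sum>n\<in>N. f n | f N. finite N \<and> (\<forall>n\<in>N. f n \<in> C n)}"

definition independent_family :: "(nat \<Rightarrow> 'm::comm_monoid_add set) \<Rightarrow> bool"
  where "independent_family C \<longleftrightarrow>
    (\<forall>f N. finite N \<longrightarrow> (\<forall>n\<in>N. f n \<in> C n) \<longrightarrow> (\<Sum>n\<in>N. f n) = 0 \<longrightarrow> (\<forall>n\<in>N. f n = 0))"


section \<open>Free associative algebras\<close>

text \<open>
  Words form the free monoid under concatenation.  Addition on \<open>word\<close> is concatenation, so that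
  the convolution product of \<^theory>\<open>HOL-Library.Poly_Mapping\<close> makes \<open>'a word \<Rightarrow>\<^sub>0 'k\<close> the monoid
  algebra of the free monoid, i.e. the free associative \<open>'k\<close>-algebra on the set of letters.
\<close>

datatype 'a word = Word (letters: "'a list")

instantiation word :: (type) monoid_add
begin
definition "0 = Word []"
definition "v + w = Word (letters v @ letters w)"
instance by standard (simp_all add: zero_word_def plus_word_def)
end

abbreviation single_word :: "'a list \<Rightarrow> 'k::zero \<Rightarrow> 'a word \<Rightarrow>\<^sub>0 'k"
  where "single_word vs c \<equiv> Poly_Mapping.single (Word vs) c"

definition ring_of_type :: "'a::ring_1 ring"
  where "ring_of_type = \<lparr>carrier = UNIV, mult = (*), one = 1, zero = 0, add = (+)\<rparr>"

definition free_algebra :: "'a set \<Rightarrow> ('a word \<Rightarrow>\<^sub>0 'k::field) ring"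
  where "free_algebra V =
    ring_of_type\<lparr>carrier := {p. \<forall>w \<in> Poly_Mapping.keys p. set (letters w) \<subseteq> V}\<rparr>"

lemma ring_free_algebra: "ring (free_algebra V :: ('a word \<Rightarrow>\<^sub>0 'k::field) ring)"
proof -
  let ?R = "free_algebra V :: ('a word \<Rightarrow>\<^sub>0 'k::field) ring"
  have add: "p + q \<in> carrier ?R" if "p \<in> carrier ?R" "q \<in> carrier ?R" for p q
    using that Poly_Mapping.keys_add[of p q]
    by (auto simp: free_algebra_def ring_of_type_def subset_iff)
  have mul: "p * q \<in> carrier ?R" if "p \<in> carrier ?R" "q \<in> carrier ?R" for p q
    using that Poly_Mapping.keys_mult[of p q]
    by (fastforce simp: free_algebra_def ring_of_type_def plus_word_def subset_iff)
  have neg: "- p \<in> carrier ?R" if "p \<in> carrier ?R" for p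
    using that by (auto simp: free_algebra_def ring_of_type_def)
  have zero: "0 \<in> carrier ?R" and one: "1 \<in> carrier ?R"
    by (auto simp: free_algebra_def ring_of_type_def zero_word_def)
  have ops: "x \<oplus>\<^bsub>?R\<^esub> y = x + y" "x \<otimes>\<^bsub>?R\<^esub> y = x * y" "\<zero>\<^bsub>?R\<^esub> = 0" "\<one>\<^bsub>?R\<^esub> = 1" for x y
    by (simp_all add: free_algebra_def ring_of_type_def)
  show ?thesis
  proof (rule ringI)
    show "abelian_group ?R"
    proof (rule abelian_groupI)
      show "\<exists>q\<in>carrier ?R. q \<oplus>\<^bsub>?R\<^esub> p = \<zero>\<^bsub>?R\<^esub>" if "p \<in> carrier ?R" for p
        by (rule bexI[OF _ neg[OF that]]) (simp add: ops)
    qed (simp_all add: ops add zero add_ac)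
    show "monoid ?R"
      by (rule monoidI) (simp_all add: ops mul one mult.assoc)
  qed (simp_all add: ops distrib_left distrib_right)
qed


section \<open>Graded algebras\<close>

locale graded_algebra = vector_space scale
  for scale :: "'k::field \<Rightarrow> 'a::ring_1 \<Rightarrow> 'a" +
  fixes A :: "nat \<Rightarrow> 'a set"
  assumes scale_mult_left: "scale c (x * y) = scale c x * y"
    and scale_mult_right: "scale c (x * y) = x * scale c y"
    and subspace_component: "subspace (A n)"
    and independent_components: "independent_family A"
    and direct_sum_components: "direct_sum A = UNIV"
    and mult_component: "x \<in> A i \<Longrightarrow> y \<in> A j \<Longrightarrow> x * y \<in> A (i + j)"
    and connected: "A 0 = range (\<lambda>c. scale c 1)"
    and finite_type: "\<exists>S. finite S \<and> A n = span S"
begin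

subsection \<open>Tensor algebras and quadratic algebras\<close>

text \<open>
  The tensor algebra of a subspace \<open>V\<close> is the free algebra on the \<^emph>\<open>set\<close> \<open>V\<close> modulo linearity of the
  letters.  The relations below generate, in each word length \<open>n\<close>, exactly the multilinearity
  relations, so that the part of length \<open>n\<close> is the usual \<open>V\<^sup>\<otimes>\<^sup>n\<close>, constructed as the free vector space
  on \<open>V\<^sup>n\<close> modulo multilinearity.
\<close>

definition linearity_relations :: "'a set \<Rightarrow> ('a word \<Rightarrow>\<^sub>0 'k) set"
  where "linearity_relations V =
    {single_word [v + w] 1 - single_word [v] 1 - single_word [w] 1 | v w. v \<in> V \<and> w \<in> V} \<union>
    {single_word [scale c v] 1 - single_word [v] c | c v. v \<in> V}"

definition linearity_ideal :: "'a set \<Rightarrow> ('a word \<Rightarrow>\<^sub>0 'k) set"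
  where "linearity_ideal V = genideal (free_algebra V) (linearity_relations V)"

definition tensor_algebra :: "'a set \<Rightarrow> ('a word \<Rightarrow>\<^sub>0 'k) set ring"
  where "tensor_algebra V = free_algebra V Quot linearity_ideal V"

definition tensor_class :: "'a set \<Rightarrow> ('a word \<Rightarrow>\<^sub>0 'k) \<Rightarrow> ('a word \<Rightarrow>\<^sub>0 'k) set"
  where "tensor_class V p = linearity_ideal V +>\<^bsub>free_algebra V\<^esub> p"

definition tensor_power :: "'a set \<Rightarrow> nat \<Rightarrow> ('a word \<Rightarrow>\<^sub>0 'k) set set"
  where "tensor_power V n = tensor_class V `
    {p \<in> carrier (free_algebra V). \<forall>w \<in> Poly_Mapping.keys p. length (letters w) = n}"

definition tensor_scalar :: "'a set \<Rightarrow> 'k \<Rightarrow> ('a word \<Rightarrow>\<^sub>0 'k) set"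
  where "tensor_scalar V c = tensor_class V (single_word [] c)"

definition tensor_subspace :: "'a set \<Rightarrow> ('a word \<Rightarrow>\<^sub>0 'k) set set \<Rightarrow> bool"
  where "tensor_subspace V \<Omega> \<longleftrightarrow>
    \<Omega> \<subseteq> carrier (tensor_algebra V) \<and> \<zero>\<^bsub>tensor_algebra V\<^esub> \<in> \<Omega> \<and>
    (\<forall>x\<in>\<Omega>. \<forall>y\<in>\<Omega>. x \<oplus>\<^bsub>tensor_algebra V\<^esub> y \<in> \<Omega>) \<and>
    (\<forall>c. \<forall>x\<in>\<Omega>. tensor_scalar V c \<otimes>\<^bsub>tensor_algebra V\<^esub> x \<in> \<Omega>)"

definition quadratic :: bool
  where "quadratic \<longleftrightarrow>
    (\<exists>\<Omega> \<phi>. let T = tensor_algebra (A 1); I = genideal T \<Omega> in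
      \<Omega> \<subseteq> tensor_power (A 1) 2 \<and> tensor_subspace (A 1) \<Omega> \<and>
      \<phi> \<in> ring_iso (T Quot I) (ring_of_type :: 'a ring) \<and>
      (\<forall>c. \<phi> (I +>\<^bsub>T\<^esub> tensor_scalar (A 1) c) = scale c 1) \<and>
      (\<forall>n. \<phi> ` ((\<lambda>t. I +>\<^bsub>T\<^esub> t) ` tensor_power (A 1) n) = A n))"

end


section \<open>Graded right modules\<close>

text \<open>
  The addition is that of the ambient type; the underlying set of a module is the internal direct
  sum of its components and need not be the whole type.  The \<open>\<bbbk>\<close>-structure is
  the one induced by \<open>A\<^sub>0 = \<bbbk>\<close>.  Grading by \<open>nat\<close> suffices for resolutions of the trivial module whose
  \<open>n\<close>-th term is generated in degree \<open>n\<close>.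
\<close>

record ('a, 'm) gr_module =
  act :: "'m \<Rightarrow> 'a \<Rightarrow> 'm"
  component :: "nat \<Rightarrow> 'm set"

abbreviation elements :: "('a, 'm::comm_monoid_add) gr_module \<Rightarrow> 'm set"
  where "elements M \<equiv> direct_sum (component M)"

context graded_algebra
begin

definition graded_right_module :: "('a, 'm::ab_group_add) gr_module \<Rightarrow> bool"
  where "graded_right_module M \<longleftrightarrow>
    (\<forall>n. 0 \<in> component M n) \<and>
    (\<forall>n. \<forall>x\<in>component M n. \<forall>y\<in>component M n. x - y \<in> component M n) \<and>
    independent_family (component M) \<and>
    (\<forall>i j. \<forall>x\<in>component M i. \<forall>a\<in>A j. act M x a \<in> component M (i + j)) \<and>
    (\<forall>x\<in>elements M. \<forall>y\<in>elements M. \<forall>a. act M (x + y) a = act M x a + act M y a) \<and>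
    (\<forall>x\<in>elements M. \<forall>a b. act M x (a + b) = act M x a + act M x b) \<and>
    (\<forall>x\<in>elements M. \<forall>a b. act M x (a * b) = act M (act M x a) b) \<and>
    (\<forall>x\<in>elements M. act M x 1 = x)"

definition graded_hom ::
    "('a, 'm::ab_group_add) gr_module \<Rightarrow> ('a, 'n::ab_group_add) gr_module \<Rightarrow> ('m \<Rightarrow> 'n) \<Rightarrow> bool"
  where "graded_hom M N f \<longleftrightarrow>
    (\<forall>x\<in>elements M. \<forall>y\<in>elements M. f (x + y) = f x + f y) \<and>
    (\<forall>x\<in>elements M. \<forall>a. f (act M x a) = act N (f x) a) \<and>
    (\<forall>n. f ` component M n \<subseteq> component N n)"

definition free_graded :: "('a, 'm::ab_group_add) gr_module \<Rightarrow> bool"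
  where "free_graded M \<longleftrightarrow>
    (\<exists>B \<subseteq> (\<Union>n. component M n). \<forall>x\<in>elements M.
      \<exists>!f :: 'm \<Rightarrow>\<^sub>0 'a. Poly_Mapping.keys f \<subseteq> B \<and>
        x = (\<Sum>b\<in>Poly_Mapping.keys f. act M b (Poly_Mapping.lookup f b)))"

definition submodule :: "('a, 'm::ab_group_add) gr_module \<Rightarrow> 'm set \<Rightarrow> bool"
  where "submodule M N \<longleftrightarrow> N \<subseteq> elements M \<and> 0 \<in> N \<and>
    (\<forall>x\<in>N. \<forall>y\<in>N. x + y \<in> N) \<and> (\<forall>x\<in>N. \<forall>a. act M x a \<in> N)"

definition finite_dim_component :: "('a, 'm::ab_group_add) gr_module \<Rightarrow> nat \<Rightarrow> bool"
  where "finite_dim_component M n \<longleftrightarrow>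
    (\<exists>S \<subseteq> component M n. finite S \<and>
      (\<forall>x\<in>component M n. \<exists>c :: 'm \<Rightarrow> 'k. x = (\<Sum>s\<in>S. act M s (scale (c s) 1))))"

definition augmentation :: "'a \<Rightarrow> 'k"
  where "augmentation a =
    (THE c. a - scale c 1 \<in> direct_sum (\<lambda>n. if n = 0 then {0} else A n))"

definition trivial_module :: "('a, 'k) gr_module"
  where "trivial_module =
    \<lparr>act = \<lambda>x a. x * augmentation a, component = \<lambda>n. if n = 0 then UNIV else {0}\<rparr>"


subsection \<open>Koszul algebras\<close>

text \<open>
  The terms \<open>P n\<close> are sought inside the fixed type \<open>nat \<Rightarrow>\<^sub>0 'a\<close>, since HOL cannot quantify over
  types.  This is no restriction: a free module generated by the finite-dimensional \<open>P(n)\<^sub>n\<close> is free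
  of finite rank, hence isomorphic to a module whose underlying set lies in that type.
\<close>

definition koszul :: bool
  where "koszul \<longleftrightarrow>
    (\<exists>(P :: nat \<Rightarrow> ('a, nat \<Rightarrow>\<^sub>0 'a) gr_module) (d :: nat \<Rightarrow> (nat \<Rightarrow>\<^sub>0 'a) \<Rightarrow> (nat \<Rightarrow>\<^sub>0 'a))
        (\<epsilon> :: (nat \<Rightarrow>\<^sub>0 'a) \<Rightarrow> 'k).
      (\<forall>n. graded_right_module (P n) \<and> free_graded (P n) \<and>
           finite_dim_component (P n) n \<and>
           submodule (P n) hull component (P n) n = elements (P n)) \<and>
      (\<forall>n. graded_hom (P (Suc n)) (P n) (d n)) \<and>
      graded_hom (P 0) trivial_module \<epsilon> \<and>
      \<epsilon> ` elements (P 0) = elements trivial_module \<and>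
      {x \<in> elements (P 0). \<epsilon> x = 0} = d 0 ` elements (P 1) \<and>
      (\<forall>n. {x \<in> elements (P (Suc n)). d n x = 0} = d (Suc n) ` elements (P (Suc (Suc n)))))"

end

end

theory Submission
  imports Defs
begin

text \<open>
  The hypotheses make \<open>A\<close> very short.  Since \<open>UU = 0\<close> and \<open>UW = A\<^sub>2\<close>, every product of three elements of
  \<open>A\<^sub>1\<close> lies in \<open>U W A\<^sub>1 \<subseteq> U A\<^sub>2 = U U W = 0\<close>, and a quadratic algebra is generated by \<open>A\<^sub>1\<close>; hence
  \<open>A = A\<^sub>0 \<oplus> A\<^sub>1 \<oplus> A\<^sub>2\<close>.  It remains to use \<open>UU = 0\<close> and \<open>U A\<^sub>1 = A\<^sub>2\<close>.

  The resolution has the terms \<open>P(n) = A\<^sup>r\<close> with generators in degree \<open>n\<close>, and the differential sends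
  the \<open>j\<close>-th unit vector to the \<open>j\<close>-th member of a list \<open>ys\<close> of vectors with entries in \<open>A\<^sub>1\<close>.  Let
  \<open>N \<subseteq> A\<^sub>1\<^sup>s\<close> be the space of linear syzygies of one stage.  The full syzygy module of that stage is
  \<open>N \<oplus> A\<^sub>2\<^sup>s\<close>, because \<open>A\<^sub>3 = 0\<close>.  If \<open>ys\<close> is a basis of \<open>N\<close>, the image of the next differential is
  \<open>N \<oplus> N A\<^sub>1\<close>.  So the only point is to show that \<open>N A\<^sub>1 = A\<^sub>2\<^sup>s\<close> at every stage.

  This is done by an induction that carries along a well-chosen ordering of the basis.  Call
  \<open>y\<^sub>1, \<dots>, y\<^sub>t\<close> tame if \<open>y\<^sub>j U \<subseteq> y\<^sub>1 A\<^sub>1 + \<dots> + y\<^sub>j\<^sub>-\<^sub>1 A\<^sub>1\<close> for all \<open>j\<close>; equivalently, in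
  each successive cyclic quotient of the module generated by the \<open>y\<^sub>j\<close>, the generator is annihilated by
  \<open>U\<close>.  If the current
  basis is tame, then for each index \<open>i\<close> and each \<open>u \<in> U\<close> there is a syzygy with \<open>i\<close>-th coordinate \<open>u\<close>
  and vanishing later coordinates (\<open>relations_have_U_leading_terms\<close>).  Multiplying such syzygies by
  elements of \<open>A\<^sub>1\<close> gives, by induction on \<open>i\<close> and because \<open>U A\<^sub>1 = A\<^sub>2\<close>, all of \<open>A\<^sub>2\<^sup>s\<close>.  Doing this
  along the flag \<open>N \<inter> A\<^sub>1\<^sup>i\<close>, refined by the condition that the last coordinate lies in \<open>U\<close>, yields
  at the same time a tame basis of the new syzygy space (\<open>tame_basis_truncated\<close>), and the induction
  continues.
\<close>

section \<open>Quadratic algebras are generated in degree one\<close>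

lemma poly_mapping_eq_sum_single:
  assumes "finite K" and "Poly_Mapping.keys p \<subseteq> K"
  shows "p = (\<Sum>k\<in>K. Poly_Mapping.single k (Poly_Mapping.lookup p k))"
proof (rule poly_mapping_eqI)
  fix i
  show "Poly_Mapping.lookup p i =
      Poly_Mapping.lookup (\<Sum>k\<in>K. Poly_Mapping.single k (Poly_Mapping.lookup p k)) i"
    using assms by (auto simp: lookup_sum lookup_single when_def in_keys_iff sum.delta)
qed

context graded_algebra
begin

text \<open>
  The composite of the two quotient maps with the isomorphism \<open>\<phi>\<close> is a ring homomorphism \<open>\<Phi>\<close> from the
  free algebra on the letters \<open>A\<^sub>1\<close>.  It sends letters into \<open>A\<^sub>1\<close>, hence words of length \<open>n\<close> to
  \<open>n\<close>-fold products, and combinations of words of length \<open>n\<close> exhaust \<open>A\<^sub>n\<close>.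
\<close>
lemma quadratic_generated_in_degree_one:
  assumes quadratic
  shows "A n \<subseteq> span {prod_list vs | vs. set vs \<subseteq> A 1 \<and> length vs = n}"
proof
  fix a assume a: "a \<in> A n"
  let ?F = "free_algebra (A 1) :: ('a word \<Rightarrow>\<^sub>0 'k) ring"
  let ?T = "tensor_algebra (A 1)"
  obtain \<Omega> \<phi> where \<Omega>: "\<Omega> \<subseteq> tensor_power (A 1) 2" "tensor_subspace (A 1) \<Omega>"
    and iso: "\<phi> \<in> ring_iso (?T Quot genideal ?T \<Omega>) (ring_of_type :: 'a ring)"
    and unit: "\<And>c. \<phi> (genideal ?T \<Omega> +>\<^bsub>?T\<^esub> tensor_scalar (A 1) c) = scale c 1"
    and grading: "\<And>n. \<phi> ` ((\<lambda>t. genideal ?T \<Omega> +>\<^bsub>?T\<^esub> t) ` tensor_power (A 1) n) = A n"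
    using assms unfolding quadratic_def Let_def by blast
  interpret F: ring ?F by (rule ring_free_algebra)
  have subA: "subspace (A 1)" by (rule subspace_component)
  have "linearity_relations (A 1) \<subseteq> carrier ?F"
  proof -
    have one: "single_word [v] c \<in> carrier ?F" if "v \<in> A 1" for v c
      using that by (auto simp: free_algebra_def ring_of_type_def)
    have min: "p - q \<in> carrier ?F" if "p \<in> carrier ?F" "q \<in> carrier ?F" for p q
      using that Poly_Mapping.keys_diff[of p q]
      by (auto simp: free_algebra_def ring_of_type_def subset_iff)
    show ?thesis
      unfolding linearity_relations_def
      using subspace_add[OF subA] subspace_scale[OF subA]
      by (auto intro!: min one simp del: One_nat_def)
  qed
  then interpret L: ideal "linearity_ideal (A 1)" ?F
    unfolding linearity_ideal_def by (rule F.genideal_ideal)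
  interpret T: ring ?T unfolding tensor_algebra_def by (rule L.quotient_is_ring)
  have "\<Omega> \<subseteq> carrier ?T" using \<Omega>(2) by (simp add: tensor_subspace_def)
  then interpret I: ideal "genideal ?T \<Omega>" ?T by (rule T.genideal_ideal)
  define \<Phi> where "\<Phi> p = \<phi> (genideal ?T \<Omega> +>\<^bsub>?T\<^esub> tensor_class (A 1) p)" for p
  have "tensor_class (A 1) \<in> ring_hom ?F ?T"
    using L.rcos_ring_hom unfolding tensor_class_def tensor_algebra_def .
  from ring_hom_trans[OF ring_hom_trans[OF this I.rcos_ring_hom], of \<phi> ring_of_type]
  have hom: "\<Phi> \<in> ring_hom ?F ring_of_type"
    using iso unfolding \<Phi>_def ring_iso_def comp_def by simp
  have add: "\<Phi> (p + q) = \<Phi> p + \<Phi> q" if "p \<in> carrier ?F" "q \<in> carrier ?F" for p q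
    using ring_hom_add[OF hom that] by (simp add: free_algebra_def ring_of_type_def)
  have mult: "\<Phi> (p * q) = \<Phi> p * \<Phi> q" if "p \<in> carrier ?F" "q \<in> carrier ?F" for p q
    using ring_hom_mult[OF hom that] by (simp add: free_algebra_def ring_of_type_def)
  have scalar: "\<Phi> (single_word [] c) = scale c 1" for c
    using unit by (simp add: \<Phi>_def tensor_scalar_def)
  have letter: "\<Phi> (single_word [v] 1) \<in> A 1" if "v \<in> A 1" for v
  proof -
    have "tensor_class (A 1) (single_word [v] 1) \<in> tensor_power (A 1) 1"
      unfolding tensor_power_def using that
      by (intro imageI) (auto simp: free_algebra_def ring_of_type_def)
    then show ?thesis using grading[of 1] unfolding \<Phi>_def by blast
  qed
  have monomial: "\<Phi> (single_word vs c) = scale c (prod_list (map (\<lambda>v. \<Phi> (single_word [v] 1)) vs))"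
    if "set vs \<subseteq> A 1" for vs c
    using that
  proof (induction vs rule: rev_induct)
    case Nil
    then show ?case by (simp add: scalar)
  next
    case (snoc v vs)
    have "single_word (vs @ [v]) c = single_word vs c * single_word [v] 1"
      by (simp add: Poly_Mapping.mult_single plus_word_def)
    moreover have "single_word vs c \<in> carrier ?F" "single_word [v] 1 \<in> carrier ?F"
      using snoc.prems by (auto simp: free_algebra_def ring_of_type_def)
    ultimately show ?case using snoc mult by (simp add: scale_mult_left)
  qed
  let ?S = "span {prod_list vs | vs. set vs \<subseteq> A 1 \<and> length vs = n}"
  have "a \<in> \<phi> ` ((\<lambda>t. genideal ?T \<Omega> +>\<^bsub>?T\<^esub> t) ` tensor_power (A 1) n)"
    using a grading[of n] by simp
  then obtain p where p: "p \<in> carrier ?F" "\<forall>w\<in>Poly_Mapping.keys p. length (letters w) = n"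
    and a_p: "a = \<Phi> p"
    unfolding tensor_power_def \<Phi>_def image_image by (elim imageE) auto
  have zero: "\<Phi> 0 = 0"
    using add[of 0 0] by (simp add: free_algebra_def ring_of_type_def)
  have term_in_span: "\<Phi> (Poly_Mapping.single w (Poly_Mapping.lookup p w)) \<in> ?S"
    and term_in_carrier: "Poly_Mapping.single w (Poly_Mapping.lookup p w) \<in> carrier ?F"
    if w: "w \<in> Poly_Mapping.keys p" for w
  proof -
    obtain vs where vs: "w = Word vs" by (cases w)
    have word: "set vs \<subseteq> A 1" "length vs = n"
      using p w by (fastforce simp: vs free_algebra_def ring_of_type_def)+
    then show "Poly_Mapping.single w (Poly_Mapping.lookup p w) \<in> carrier ?F"
      by (auto simp: vs free_algebra_def ring_of_type_def)
    let ?us = "map (\<lambda>v. \<Phi> (single_word [v] 1)) vs"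
    have "set ?us \<subseteq> A 1" "length ?us = n" using word letter by auto
    then have "prod_list ?us \<in> ?S" by (intro span_base) blast
    then show "\<Phi> (Poly_Mapping.single w (Poly_Mapping.lookup p w)) \<in> ?S"
      unfolding vs monomial[OF word(1)] by (rule span_scale)
  qed
  have "(\<Sum>w\<in>K. Poly_Mapping.single w (Poly_Mapping.lookup p w)) \<in> carrier ?F \<and>
      \<Phi> (\<Sum>w\<in>K. Poly_Mapping.single w (Poly_Mapping.lookup p w)) \<in> ?S"
    if "finite K" "K \<subseteq> Poly_Mapping.keys p" for K
    using that
  proof (induction K rule: finite_induct)
    case empty
    show ?case by (simp add: zero span_zero) (simp add: free_algebra_def ring_of_type_def)
  next
    case (insert w K)
    have "x + y \<in> carrier ?F" if "x \<in> carrier ?F" "y \<in> carrier ?F" for x y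
      using F.a_closed[OF that] by (simp add: free_algebra_def ring_of_type_def)
    then show ?case
      using insert term_in_span[of w] term_in_carrier[of w] by (simp add: add span_add)
  qed
  from this[of "Poly_Mapping.keys p"] have "\<Phi> p \<in> ?S"
    using poly_mapping_eq_sum_single[of "Poly_Mapping.keys p" p] by simp
  then show "a \<in> ?S" using p a_p by simp
qed

end


section \<open>Coordinate vectors over a graded algebra\<close>

context graded_algebra
begin

text \<open>
  A vector in \<open>S\<^sup>r\<close> is stored as a finitely supported function on all of \<open>nat\<close> that vanishes from
  position \<open>r\<close> on.  In this way \<open>S\<^sup>i \<subseteq> S\<^sup>r\<close> for \<open>i \<le> r\<close> is a literal inclusion, and all vectors inhabit
  the type required for the terms of a resolution.
\<close>
definition vecs :: "nat \<Rightarrow> 'a set \<Rightarrow> (nat \<Rightarrow>\<^sub>0 'a) set"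
  where "vecs r S = {x. (\<forall>i. Poly_Mapping.lookup x i \<in> S) \<and> (\<forall>i\<ge>r. Poly_Mapping.lookup x i = 0)}"

definition ract :: "(nat \<Rightarrow>\<^sub>0 'a) \<Rightarrow> 'a \<Rightarrow> (nat \<Rightarrow>\<^sub>0 'a)"
  where "ract x a = Poly_Mapping.map (\<lambda>b. b * a) x"

lemma lookup_ract [simp]: "Poly_Mapping.lookup (ract x a) i = Poly_Mapping.lookup x i * a"
  unfolding ract_def by transfer (simp add: when_def)

text \<open>
  The \<open>\<bbbk>\<close>-structure is the restriction of the right action to \<open>A\<^sub>0 = \<bbbk>\<close>, so that every \<open>A\<close>-linear map is
  \<open>\<bbbk>\<close>-linear without further proof.
\<close>
definition vscale :: "'k \<Rightarrow> (nat \<Rightarrow>\<^sub>0 'a) \<Rightarrow> (nat \<Rightarrow>\<^sub>0 'a)"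
  where "vscale c x = ract x (scale c 1)"

lemma lookup_vscale [simp]:
  "Poly_Mapping.lookup (vscale c x) i = scale c (Poly_Mapping.lookup x i)"
  by (simp add: vscale_def scale_mult_right[symmetric])

sublocale vec: vector_space vscale
  by standard (auto intro!: poly_mapping_eqI simp: lookup_add scale_right_distrib scale_left_distrib)

lemma ract_add_left: "ract (x + y) a = ract x a + ract y a"
  and ract_add_right: "ract x (a + b) = ract x a + ract x b"
  and ract_mult: "ract x (a * b) = ract (ract x a) b"
  and ract_one: "ract x 1 = x"
  and ract_zero_left: "ract 0 a = 0"
  and ract_zero_right: "ract x 0 = 0"
  and ract_vscale_left: "ract (vscale c x) a = vscale c (ract x a)"
  by (auto intro!: poly_mapping_eqI
      simp: lookup_add algebra_simps scale_mult_left[symmetric] scale_mult_right[symmetric])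

lemma ract_sum: "ract (sum f I) a = (\<Sum>i\<in>I. ract (f i) a)"
  by (rule poly_mapping_eqI) (simp add: lookup_sum sum_distrib_right)

lemma ract_single: "ract (Poly_Mapping.single i a) b = Poly_Mapping.single i (a * b)"
  by (rule poly_mapping_eqI) (simp add: lookup_single when_def)

lemma zero_mem [simp]: "0 \<in> A n"
  using subspace_0[OF subspace_component] .

lemma subspace_vecs: "subspace S \<Longrightarrow> vec.subspace (vecs r S)"
  unfolding vec.subspace_def vecs_def
  by (auto simp: lookup_add subspace_0 subspace_add subspace_scale)

lemma vecs_mono: "r \<le> r' \<Longrightarrow> S \<subseteq> S' \<Longrightarrow> vecs r S \<subseteq> vecs r' S'"
  unfolding vecs_def by auto

lemma single_in_vecs: "i < r \<Longrightarrow> a \<in> S \<Longrightarrow> 0 \<in> S \<Longrightarrow> Poly_Mapping.single i a \<in> vecs r S"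
  by (auto simp: vecs_def lookup_single when_def)

lemma vscale_single: "vscale c (Poly_Mapping.single i a) = Poly_Mapping.single i (scale c a)"
  by (rule poly_mapping_eqI) (simp add: lookup_single when_def)

lemma subspace_single_preimage:
  assumes "vec.subspace T"
  shows "subspace {a. Poly_Mapping.single i a \<in> T}"
  using vec.subspace_0[OF assms] vec.subspace_add[OF assms] vec.subspace_scale[OF assms]
  by (auto simp: subspace_def single_add vscale_single[symmetric])

lemma vecs_keys: "x \<in> vecs r S \<Longrightarrow> Poly_Mapping.keys x \<subseteq> {..<r}"
  unfolding vecs_def by (auto simp: in_keys_iff) (meson not_le)

lemma vecs_0: "subspace S \<Longrightarrow> vecs 0 S = {0}"
  by (auto simp: vecs_def subspace_0 intro!: poly_mapping_eqI)

lemma ract_vecs: "x \<in> vecs r (A i) \<Longrightarrow> a \<in> A j \<Longrightarrow> ract x a \<in> vecs r (A (i + j))"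
  by (simp add: vecs_def mult_component)

lemma vecs_component_finite_dimensional:
  obtains S where "finite S" "vecs r (A n) \<subseteq> vec.span S"
proof -
  obtain S where S: "finite S" "A n = span S" using finite_type by blast
  let ?S = "(\<lambda>(i, a). Poly_Mapping.single i a) ` ({..<r} \<times> S)"
  have single: "Poly_Mapping.single i a \<in> vec.span ?S" if "i < r" "a \<in> A n" for i a
  proof -
    let ?T = "{a. Poly_Mapping.single i a \<in> vec.span ?S}"
    have "subspace ?T" by (rule subspace_single_preimage) simp
    moreover have "S \<subseteq> ?T" using that(1) by (auto intro!: vec.span_base)
    ultimately show ?thesis using span_minimal[of S ?T] S(2) that(2) by blast
  qed
  have "vecs r (A n) \<subseteq> vec.span ?S"
  proof
    fix x assume x: "x \<in> vecs r (A n)"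
    have "x = (\<Sum>i<r. Poly_Mapping.single i (Poly_Mapping.lookup x i))"
      using poly_mapping_eq_sum_single[OF finite_lessThan vecs_keys[OF x]] .
    also have "\<dots> \<in> vec.span ?S"
      using x by (intro vec.span_sum single) (auto simp: vecs_def)
    finally show "x \<in> vec.span ?S" .
  qed
  with S(1) show ?thesis by (intro that[of ?S]) auto
qed

text \<open>
  The \<open>A\<close>-linear map with matrix columns \<open>ys\<close>; these maps are the differentials of the resolution.
\<close>
definition comb :: "(nat \<Rightarrow>\<^sub>0 'a) list \<Rightarrow> (nat \<Rightarrow>\<^sub>0 'a) \<Rightarrow> (nat \<Rightarrow>\<^sub>0 'a)"
  where "comb ys x = (\<Sum>j<length ys. ract (ys ! j) (Poly_Mapping.lookup x j))"

lemma comb_add: "comb ys (x + y) = comb ys x + comb ys y"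
  by (simp add: comb_def lookup_add ract_add_right sum.distrib)

lemma comb_diff: "comb ys (x - y) = comb ys x - comb ys y"
  using comb_add[of ys "x - y" y] by (simp add: algebra_simps)

lemma comb_ract: "comb ys (ract x a) = ract (comb ys x) a"
  by (simp add: comb_def ract_sum ract_mult)

lemma comb_vscale: "comb ys (vscale c x) = vscale c (comb ys x)"
  by (simp add: vscale_def comb_ract)

lemma comb_zero [simp]: "comb ys 0 = 0"
  by (simp add: comb_def ract_zero_right)

lemma comb_single: "j < length ys \<Longrightarrow> comb ys (Poly_Mapping.single j a) = ract (ys ! j) a"
  by (simp add: comb_def lookup_single when_def if_distrib[of "ract _"] ract_zero_right sum.delta
      cong: if_cong)

lemma comb_vecs:
  assumes "set ys \<subseteq> vecs s (A i)" and "x \<in> vecs r (A j)"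
  shows "comb ys x \<in> vecs s (A (i + j))"
  unfolding comb_def using assms
  by (intro vec.subspace_sum subspace_vecs subspace_component ract_vecs)
    (auto simp: vecs_def subset_iff)

text \<open>
  The space \<open>E A\<^sub>k\<close>, that is, the part of the submodule generated by \<open>E\<close> that lies \<open>k\<close> degrees above \<open>E\<close>.
\<close>
definition products :: "nat \<Rightarrow> (nat \<Rightarrow>\<^sub>0 'a) set \<Rightarrow> (nat \<Rightarrow>\<^sub>0 'a) set"
  where "products k E = vec.span {ract y a | y a. y \<in> E \<and> a \<in> A k}"

lemma subspace_products: "vec.subspace (products k E)"
  by (simp add: products_def)

lemma products_mono: "E \<subseteq> F \<Longrightarrow> products k E \<subseteq> products k F"
  unfolding products_def by (rule vec.span_mono) blast

lemma ract_in_products: "y \<in> E \<Longrightarrow> a \<in> A k \<Longrightarrow> ract y a \<in> products k E"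
  unfolding products_def by (rule vec.span_base) blast

lemma products_span: "products k (vec.span E) = products k E"
proof
  show "products k E \<subseteq> products k (vec.span E)"
    by (rule products_mono) (rule vec.span_superset)
  have "ract y a \<in> products k E" if "y \<in> vec.span E" "a \<in> A k" for y a
    using that(1)
  proof (induction y rule: vec.span_induct_alt)
    case base
    show ?case by (simp add: ract_zero_left products_def vec.span_zero)
  next
    case (step c x y)
    then show ?case
      using ract_in_products[OF step(1) that(2)]
      by (simp add: ract_add_left ract_vscale_left products_def vec.span_add vec.span_scale)
  qed
  then show "products k (vec.span E) \<subseteq> products k E"
    unfolding products_def[of k "vec.span E"]
    by (intro vec.span_minimal) (auto simp: products_def)
qed

lemma products_set_subset_comb: "products k (set zs) \<subseteq> comb zs ` vecs (length zs) (A k)"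
  unfolding products_def
proof (rule vec.span_minimal)
  let ?I = "comb zs ` vecs (length zs) (A k)"
  have V: "vec.subspace (vecs (length zs) (A k))" by (intro subspace_vecs subspace_component)
  show "vec.subspace ?I"
    unfolding vec.subspace_def
    using vec.subspace_0[OF V] vec.subspace_add[OF V] vec.subspace_scale[OF V]
    by (auto simp: comb_add[symmetric] comb_vscale[symmetric] intro: image_eqI[of _ _ 0])
  show "{ract y a | y a. y \<in> set zs \<and> a \<in> A k} \<subseteq> ?I"
  proof clarsimp
    fix y a assume "y \<in> set zs" and a: "a \<in> A k"
    then obtain j where "j < length zs" "y = zs ! j" by (auto simp: in_set_conv_nth)
    then show "ract y a \<in> ?I"
      using a by (intro image_eqI[of _ _ "Poly_Mapping.single j a"])
        (auto simp: comb_single intro: single_in_vecs)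
  qed
qed

lemma one_in_A0: "1 \<in> A 0"
  unfolding connected by (rule range_eqI[of _ _ 1]) simp

lemma span_set_eq_comb: "vec.span (set zs) = comb zs ` vecs (length zs) (A 0)"
proof
  have "set zs \<subseteq> products 0 (set zs)"
    using one_in_A0 ract_in_products[of _ "set zs" 1 0] by (auto simp: ract_one)
  then have "vec.span (set zs) \<subseteq> products 0 (set zs)"
    by (rule vec.span_minimal) (simp add: products_def)
  then show "vec.span (set zs) \<subseteq> comb zs ` vecs (length zs) (A 0)"
    using products_set_subset_comb by blast
  show "comb zs ` vecs (length zs) (A 0) \<subseteq> vec.span (set zs)"
  proof clarify
    fix x assume x: "x \<in> vecs (length zs) (A 0)"
    show "comb zs x \<in> vec.span (set zs)"
      unfolding comb_def
    proof (rule vec.span_sum)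
      fix j assume j: "j \<in> {..<length zs}"
      obtain c where "Poly_Mapping.lookup x j = scale c 1"
        using x unfolding vecs_def connected by auto
      then show "ract (zs ! j) (Poly_Mapping.lookup x j) \<in> vec.span (set zs)"
        using j by (simp add: vscale_def[symmetric] vec.span_scale vec.span_base)
    qed
  qed
qed

text \<open>
  On coordinate vectors of degree \<open>0\<close> the map \<^term>\<open>comb ys\<close> forms linear combinations of \<open>ys\<close> over
  \<open>\<bbbk>\<close>; so a differential built from a basis is injective in the lowest degree.
\<close>
lemma comb_injective_on_scalars:
  assumes "distinct ys" and "vec.independent (set ys)"
    and x: "x \<in> vecs (length ys) (A 0)" and "comb ys x = 0"
  shows "x = 0"
proof -
  have "\<forall>j. \<exists>c. Poly_Mapping.lookup x j = scale c 1"
    using x unfolding vecs_def connected by auto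
  then obtain c where c: "\<And>j. Poly_Mapping.lookup x j = scale (c j) 1" by metis
  let ?u = "\<lambda>v. c (the_inv_into {..<length ys} ((!) ys) v)"
  have bij: "bij_betw ((!) ys) {..<length ys} (set ys)"
    using assms(1) by (simp add: bij_betw_nth)
  have inv: "the_inv_into {..<length ys} ((!) ys) (ys ! j) = j" if "j < length ys" for j
    using bij that by (auto simp: bij_betw_def intro: the_inv_into_f_f)
  have "(\<Sum>v\<in>set ys. vscale (?u v) v) = (\<Sum>j<length ys. vscale (?u (ys ! j)) (ys ! j))"
    using sum.reindex_bij_betw[OF bij, of "\<lambda>v. vscale (?u v) v"] by simp
  also have "\<dots> = comb ys x"
    unfolding comb_def by (intro sum.cong) (simp_all add: inv c vscale_def)
  finally have "(\<Sum>v\<in>set ys. vscale (?u v) v) = 0" using assms(4) by simp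
  note u_zero = vec.independentD[OF assms(2) finite_set subset_refl this]
  have "c j = 0" if "j < length ys" for j
    using u_zero[OF nth_mem[OF that]] unfolding inv[OF that] .
  then have "Poly_Mapping.lookup x j = 0" for j
    using x c[of j] by (cases "j < length ys") (simp_all add: vecs_def)
  then show ?thesis by (intro poly_mapping_eqI) simp
qed

end


section \<open>Tame bases\<close>

text \<open>
  From \<open>UW = A\<^sub>2\<close> and \<open>W \<subseteq> A\<^sub>1\<close> one has \<open>U A\<^sub>1 = A\<^sub>2\<close>; quadraticity enters through the vanishing of \<open>A\<close> in
  degrees \<open>\<ge> 3\<close>.
\<close>
locale split_algebra = graded_algebra scale A
  for scale :: "'k::field \<Rightarrow> 'a::ring_1 \<Rightarrow> 'a" and A :: "nat \<Rightarrow> 'a set" +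
  fixes U :: "'a set"
  assumes subspace_U: "subspace U"
    and U_subset: "U \<subseteq> A 1"
    and U_square_zero: "u \<in> U \<Longrightarrow> u' \<in> U \<Longrightarrow> u * u' = 0"
    and degree_2: "A 2 = span {u * v | u v. u \<in> U \<and> v \<in> A 1}"
    and degree_ge_3: "n \<ge> 3 \<Longrightarrow> A n = {0}"
begin

definition tame :: "(nat \<Rightarrow>\<^sub>0 'a) list \<Rightarrow> bool"
  where "tame ys \<longleftrightarrow>
    (\<forall>j<length ys. \<forall>u\<in>U. ract (ys ! j) u \<in> products 1 (set (take j ys)))"

text \<open>
  A basis is a list here because tameness refers to the order of its members.
\<close>
definition tame_basis :: "(nat \<Rightarrow>\<^sub>0 'a) list \<Rightarrow> (nat \<Rightarrow>\<^sub>0 'a) set \<Rightarrow> bool"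
  where "tame_basis ys E \<longleftrightarrow>
    distinct ys \<and> vec.independent (set ys) \<and> vec.span (set ys) = E \<and> tame ys"

text \<open>
  Every member added to the list is absorbed by \<open>E A\<^sub>1\<close> when multiplied by \<open>U\<close>, and \<open>E A\<^sub>1\<close> is generated
  by the members that come before all the added ones.  So any completion of the basis, in any order,
  stays tame.
\<close>
lemma tame_basis_extend:
  assumes basis: "tame_basis ys E"
    and F: "vec.subspace F" "E \<subseteq> F" "F \<subseteq> vecs s (A 1)"
    and U_absorbed: "\<And>x u. x \<in> F \<Longrightarrow> u \<in> U \<Longrightarrow> ract x u \<in> products 1 E"
  obtains zs where "tame_basis zs F"
proof -
  have ys: "distinct ys" "vec.independent (set ys)" "vec.span (set ys) = E" "tame ys"
    using basis by (auto simp: tame_basis_def)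
  have "set ys \<subseteq> F" using vec.span_superset[of "set ys"] F(2) unfolding ys(3) by (rule order_trans)
  from vec.maximal_independent_subset_extend[OF this ys(2)]
  obtain B where B: "set ys \<subseteq> B" "B \<subseteq> F" "vec.independent B" "F \<subseteq> vec.span B" .
  obtain S where S: "finite S" "vecs s (A 1) \<subseteq> vec.span S"
    using vecs_component_finite_dimensional[of s 1] .
  have "B \<subseteq> vec.span S" using B(2) F(3) S(2) by (meson order_trans)
  then have "finite B" using vec.independent_span_bound[OF S(1) B(3)] by blast
  then have "finite (B - set ys)" by simp
  then obtain zs where zs: "set zs = B - set ys" "distinct zs"
    using finite_distinct_list by metis
  have set: "set (ys @ zs) = B" using zs B(1) by auto
  have "vec.span B = F"
    using vec.span_minimal[OF B(2) F(1)] B(4) by (rule equalityI)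
  moreover have "tame (ys @ zs)"
    unfolding tame_def
  proof (intro allI impI ballI)
    fix j u assume j: "j < length (ys @ zs)" and u: "u \<in> U"
    show "ract ((ys @ zs) ! j) u \<in> products 1 (set (take j (ys @ zs)))"
    proof (cases "j < length ys")
      case True
      then have "(ys @ zs) ! j = ys ! j" "take j (ys @ zs) = take j ys"
        by (simp_all add: nth_append)
      then show ?thesis using ys(4) u True by (simp only: tame_def)
    next
      case False
      have "(ys @ zs) ! j \<in> F" using nth_mem[OF j] B(2) unfolding set by (rule subsetD[rotated])
      then have "ract ((ys @ zs) ! j) u \<in> products 1 E" using u by (rule U_absorbed)
      also have "products 1 E = products 1 (set ys)"
        using products_span[of 1 "set ys"] unfolding ys(3) .
      also have "\<dots> \<subseteq> products 1 (set (take j (ys @ zs)))"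
        using False by (intro products_mono) simp
      finally show ?thesis .
    qed
  qed
  moreover have "distinct (ys @ zs)" using ys(1) zs by auto
  ultimately have "tame_basis (ys @ zs) F"
    unfolding tame_basis_def set by (intro conjI B(3))
  then show ?thesis by (rule that)
qed

text \<open>
  Vectors are compared by their last nonvanishing coordinate.  The property below passes from a
  stage of the resolution to the next: it follows from tameness of the previous basis, and it is
  what makes a tame basis of \<open>N\<close> exist.
\<close>
definition has_U_leading_terms :: "nat \<Rightarrow> (nat \<Rightarrow>\<^sub>0 'a) set \<Rightarrow> bool"
  where "has_U_leading_terms s N \<longleftrightarrow>
    (\<forall>i<s. \<forall>u\<in>U. \<exists>y\<in>N. Poly_Mapping.lookup y i = u \<and> (\<forall>j>i. Poly_Mapping.lookup y j = 0))"

text \<open>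
  The induction step refines \<open>E = N \<inter> A\<^sub>1\<^sup>i \<subseteq> F = N \<inter> A\<^sub>1\<^sup>i\<^sup>+\<^sup>1\<close> by the subspace \<open>H\<close> of those vectors in
  \<open>F\<close> whose last coordinate lies in \<open>U\<close>.  As \<open>UU = 0\<close>, multiplying \<open>H\<close> by \<open>U\<close> kills that coordinate, so
  \<open>H U \<subseteq> A\<^sub>2\<^sup>i = E A\<^sub>1\<close>.  As \<open>U A\<^sub>1 = A\<^sub>2\<close> and \<open>N\<close> contains vectors with leading term \<open>u\<close> at position
  \<open>i\<close>, already \<open>H A\<^sub>1\<close> is all of \<open>A\<^sub>2\<^sup>i\<^sup>+\<^sup>1\<close>, and this trivially contains \<open>F U\<close>.  Thus a tame basis can be
  extended first from \<open>E\<close> to \<open>H\<close> and then from \<open>H\<close> to \<open>F\<close>.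
\<close>
lemma tame_basis_truncated:
  assumes N: "vec.subspace N" "N \<subseteq> vecs s (A 1)" "has_U_leading_terms s N"
    and "i \<le> s"
  shows "\<exists>ys. tame_basis ys (N \<inter> vecs i (A 1)) \<and>
    vecs i (A 2) \<subseteq> products 1 (N \<inter> vecs i (A 1))"
  using assms(4)
proof (induction i)
  case 0
  have "N \<inter> vecs 0 (A 1) = {0}" "vecs 0 (A 2) = {0}"
    using vec.subspace_0[OF N(1)] by (auto simp: vecs_0 subspace_component)
  then show ?case
    by (intro exI[of _ "[]"])
      (simp add: tame_basis_def tame_def products_def vec.span_zero vec.independent_empty)
next
  case (Suc i)
  then obtain ys where ys: "tame_basis ys (N \<inter> vecs i (A 1))"
    and full: "vecs i (A 2) \<subseteq> products 1 (N \<inter> vecs i (A 1))"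
    by auto
  let ?E = "N \<inter> vecs i (A 1)" and ?F = "N \<inter> vecs (Suc i) (A 1)"
  let ?H = "{x \<in> ?F. Poly_Mapping.lookup x i \<in> U}"
  have subF: "vec.subspace ?F"
    by (intro vec.subspace_inter N(1) subspace_vecs subspace_component)
  have subH: "vec.subspace ?H"
    using subF subspace_0[OF subspace_U] subspace_add[OF subspace_U] subspace_scale[OF subspace_U]
    by (auto simp: vec.subspace_def lookup_add)
  have EH: "?E \<subseteq> ?H"
    using vecs_mono[of i "Suc i" "A 1" "A 1"] subspace_0[OF subspace_U] by (auto simp: vecs_def)
  have lower: "x \<in> vecs i (A 2)" if "x \<in> vecs (Suc i) (A 2)" "Poly_Mapping.lookup x i = 0" for x
    using that unfolding vecs_def by (auto simp: Suc_le_eq) (metis le_neq_implies_less)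
  have deg2: "ract x a \<in> vecs (Suc i) (A 2)" if "x \<in> ?F" "a \<in> A 1" for x a
    using ract_vecs[of x "Suc i" 1 a 1] that by (simp add: numeral_2_eq_2)
  have fullH: "vecs i (A 2) \<subseteq> products 1 ?H"
    using full products_mono[OF EH] by blast
  have single: "Poly_Mapping.single i b \<in> products 1 ?H" if "b \<in> A 2" for b
  proof -
    let ?T = "{b. Poly_Mapping.single i b \<in> products 1 ?H}"
    have "subspace ?T" by (rule subspace_single_preimage[OF subspace_products])
    moreover have "u * v \<in> ?T" if u: "u \<in> U" and v: "v \<in> A 1" for u v
    proof -
      obtain y where y: "y \<in> N" "Poly_Mapping.lookup y i = u" "\<forall>j>i. Poly_Mapping.lookup y j = 0"
        using N(3) u Suc.prems unfolding has_U_leading_terms_def by (meson Suc_le_eq)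
      have yH: "y \<in> ?H" using y u N(2) by (auto simp: vecs_def subset_iff Suc_le_eq)
      then have yv: "ract y v \<in> products 1 ?H" using v by (rule ract_in_products)
      \<comment> \<open>The product \<open>y v\<close> has the right last coordinate; the earlier ones are removed with \<open>fullH\<close>.\<close>
      let ?z = "ract y v - Poly_Mapping.single i (u * v)"
      have "u * v \<in> A 2" using mult_component[of u 1 v 1] u v U_subset by (auto simp: numeral_2_eq_2)
      then have "?z \<in> vecs (Suc i) (A 2)"
        using deg2[of y v] yH v
        by (intro vec.subspace_diff subspace_vecs subspace_component single_in_vecs) auto
      then have "?z \<in> vecs i (A 2)" by (rule lower) (simp add: lookup_minus y(2))
      then have "ract y v - ?z \<in> products 1 ?H"
        using yv fullH by (blast intro: vec.subspace_diff[OF subspace_products])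
      then show ?thesis by simp
    qed
    ultimately have "span {u * v | u v. u \<in> U \<and> v \<in> A 1} \<subseteq> ?T"
      by (intro span_minimal) auto
    then show ?thesis using that degree_2 by blast
  qed
  have fullH': "vecs (Suc i) (A 2) \<subseteq> products 1 ?H"
  proof
    fix x assume x: "x \<in> vecs (Suc i) (A 2)"
    let ?s = "Poly_Mapping.single i (Poly_Mapping.lookup x i)"
    have "Poly_Mapping.lookup x i \<in> A 2" using x by (simp add: vecs_def)
    then have s: "?s \<in> products 1 ?H" "?s \<in> vecs (Suc i) (A 2)"
      by (blast intro: single, blast intro: single_in_vecs zero_mem)
    have "x - ?s \<in> vecs (Suc i) (A 2)"
      using x s(2) by (intro vec.subspace_diff subspace_vecs subspace_component)
    then have "x - ?s \<in> vecs i (A 2)" by (rule lower) (simp add: lookup_minus)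
    then have "(x - ?s) + ?s \<in> products 1 ?H"
      using fullH s(1) by (blast intro: vec.subspace_add[OF subspace_products])
    then show "x \<in> products 1 ?H" by simp
  qed
  \<comment> \<open>This is the step that uses \<open>UU = 0\<close>.\<close>
  have "ract x u \<in> products 1 ?E" if x: "x \<in> ?H" and u: "u \<in> U" for x u
  proof -
    have "ract x u \<in> vecs (Suc i) (A 2)" using deg2 x u U_subset by blast
    moreover have "Poly_Mapping.lookup (ract x u) i = 0" using x u U_square_zero by simp
    ultimately show ?thesis using lower full by blast
  qed
  then obtain ys' where ys': "tame_basis ys' ?H"
    using tame_basis_extend[OF ys subH EH, of "Suc i"] by auto
  have "ract x u \<in> products 1 ?H" if "x \<in> ?F" "u \<in> U" for x u
    using deg2[of x u] that U_subset fullH' by blast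
  then obtain zs where "tame_basis zs ?F"
    using tame_basis_extend[OF ys' subF, of "Suc i"] by auto
  moreover have "vecs (Suc i) (A 2) \<subseteq> products 1 ?F"
    using fullH' products_mono[of ?H ?F 1] by blast
  ultimately show ?case by blast
qed

text \<open>
  The last condition is the surjectivity \<open>N A\<^sub>1 = A\<^sub>2\<^sup>s\<close>, expressed by the members of the basis.
\<close>
definition syzygy_basis :: "nat \<Rightarrow> (nat \<Rightarrow>\<^sub>0 'a) set \<Rightarrow> (nat \<Rightarrow>\<^sub>0 'a) list \<Rightarrow> bool"
  where "syzygy_basis s N ys \<longleftrightarrow>
    tame_basis ys N \<and> N \<subseteq> vecs s (A 1) \<and> vecs s (A 2) \<subseteq> products 1 (set ys)"

lemma syzygy_basis_exists:
  assumes N: "vec.subspace N" "N \<subseteq> vecs s (A 1)" "has_U_leading_terms s N"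
  shows "\<exists>ys. syzygy_basis s N ys"
proof -
  have "N \<inter> vecs s (A 1) = N" using N(2) by blast
  then obtain ys where ys: "tame_basis ys N" "vecs s (A 2) \<subseteq> products 1 N"
    using tame_basis_truncated[OF N order_refl] by auto
  then have "vecs s (A 2) \<subseteq> products 1 (set ys)"
    using products_span[of 1 "set ys"] by (simp add: tame_basis_def)
  then show ?thesis using ys(1) N(2) unfolding syzygy_basis_def by blast
qed

definition relations :: "(nat \<Rightarrow>\<^sub>0 'a) list \<Rightarrow> (nat \<Rightarrow>\<^sub>0 'a) set"
  where "relations ys = {x \<in> vecs (length ys) (A 1). comb ys x = 0}"

lemma subspace_relations: "vec.subspace (relations ys)"
  using subspace_vecs[OF subspace_component[of 1], of "length ys"]
  by (auto simp: relations_def vec.subspace_def comb_add comb_vscale)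

text \<open>
  By tameness \<open>y\<^sub>i u = \<Sum>\<^sub>j\<^sub><\<^sub>i y\<^sub>j x\<^sub>j\<close> with \<open>x\<^sub>j \<in> A\<^sub>1\<close>.  Read as a relation, this is a vector with
  coordinate \<open>u\<close> at \<open>i\<close>, coordinates \<open>-x\<^sub>j\<close> before and \<open>0\<close> after.
\<close>
lemma relations_have_U_leading_terms:
  assumes "tame ys"
  shows "has_U_leading_terms (length ys) (relations ys)"
  unfolding has_U_leading_terms_def
proof (intro allI impI ballI)
  fix i u assume i: "i < length ys" and u: "u \<in> U"
  then have "ract (ys ! i) u \<in> products 1 (set (take i ys))"
    using assms by (simp add: tame_def)
  then obtain x where x: "x \<in> vecs i (A 1)" and eq: "ract (ys ! i) u = comb (take i ys) x"
    using products_set_subset_comb[of 1 "take i ys"] i by (auto simp: min_def split: if_splits)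
  have "comb ys x = (\<Sum>j<i. ract (ys ! j) (Poly_Mapping.lookup x j))"
    unfolding comb_def using i x
    by (intro sum.mono_neutral_right) (auto simp: vecs_def ract_zero_right)
  also have "\<dots> = comb (take i ys) x"
    unfolding comb_def using i by (intro sum.cong) auto
  finally have "comb ys (Poly_Mapping.single i u - x) = 0"
    using eq i by (simp add: comb_diff comb_single)
  moreover have "Poly_Mapping.single i u - x \<in> vecs (length ys) (A 1)"
    using i u U_subset x vecs_mono[of i "length ys" "A 1" "A 1"]
    by (intro vec.subspace_diff subspace_vecs subspace_component single_in_vecs)
      (auto simp: less_imp_le)
  ultimately show "\<exists>y\<in>relations ys. Poly_Mapping.lookup y i = u \<and>
      (\<forall>j>i. Poly_Mapping.lookup y j = 0)"
    using x by (intro bexI[of _ "Poly_Mapping.single i u - x"])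
      (auto simp: relations_def vecs_def lookup_minus lookup_single)
qed

text \<open>
  The recursion starts with the module \<open>\<bbbk>\<close>, generated by one element that \<open>U\<close> annihilates; its linear
  syzygy space is all of \<open>A\<^sub>1\<close>.
\<close>
lemma syzygy_bases_exist:
  obtains X where "syzygy_basis 1 (vecs 1 (A 1)) (X 0)"
    and "\<And>n. syzygy_basis (length (X n)) (relations (X n)) (X (Suc n))"
proof -
  let ?P = "\<lambda>n ys. if n = 0 then syzygy_basis 1 (vecs 1 (A 1)) ys else tame ys"
  let ?Q = "\<lambda>_ ys zs. syzygy_basis (length ys) (relations ys) zs"
  have "has_U_leading_terms 1 (vecs 1 (A 1))"
    unfolding has_U_leading_terms_def
  proof (intro allI impI ballI)
    fix i :: nat and u assume "i < 1" "u \<in> U"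
    then show "\<exists>y\<in>vecs 1 (A 1). Poly_Mapping.lookup y i = u \<and>
        (\<forall>j>i. Poly_Mapping.lookup y j = 0)"
      using U_subset by (intro bexI[of _ "Poly_Mapping.single i u"] single_in_vecs)
        (auto simp: lookup_single)
  qed
  then have "\<exists>ys. ?P 0 ys"
    using syzygy_basis_exists subspace_vecs[OF subspace_component] by simp
  moreover have "\<exists>zs. ?P (Suc n) zs \<and> ?Q n ys zs" if "?P n ys" for ys n
  proof -
    have "tame ys" using that by (auto simp: syzygy_basis_def tame_basis_def split: if_splits)
    then obtain zs where "?Q n ys zs"
      using syzygy_basis_exists[OF subspace_relations _ relations_have_U_leading_terms]
      by (auto simp: relations_def)
    then show ?thesis by (auto simp: syzygy_basis_def tame_basis_def)
  qed
  ultimately have "\<exists>X. \<forall>n. ?P n (X n) \<and> ?Q n (X n) (X (Suc n))"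
    by (rule dependent_nat_choice)
  then obtain X where X: "\<forall>n. ?P n (X n) \<and> ?Q n (X n) (X (Suc n))" ..
  show ?thesis
  proof (rule that)
    show "syzygy_basis 1 (vecs 1 (A 1)) (X 0)" using spec[OF X, of 0] by simp
    show "syzygy_basis (length (X n)) (relations (X n)) (X (Suc n))" for n
      using spec[OF X, of n] by simp
  qed
qed


section \<open>Images and kernels of the differentials\<close>

lemma graded_decomposition:
  obtains x0 x1 x2 where "x0 \<in> A 0" "x1 \<in> A 1" "x2 \<in> A 2" "a = x0 + x1 + x2"
proof -
  let ?T = "{x0 + x1 + x2 | x0 x1 x2. x0 \<in> A 0 \<and> x1 \<in> A 1 \<and> x2 \<in> A 2}"
  have inT: "x0 + x1 + x2 \<in> ?T" if "x0 \<in> A 0" "x1 \<in> A 1" "x2 \<in> A 2" for x0 x1 x2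
    using that by blast
  have "subspace ?T"
    unfolding subspace_def
  proof (intro conjI ballI allI)
    show "0 \<in> ?T" using inT[of 0 0 0] by simp
    show "x + y \<in> ?T" if x: "x \<in> ?T" and y: "y \<in> ?T" for x y
    proof -
      obtain x0 x1 x2 y0 y1 y2 where xy: "x = x0 + x1 + x2" "y = y0 + y1 + y2"
        "x0 \<in> A 0" "x1 \<in> A 1" "x2 \<in> A 2" "y0 \<in> A 0" "y1 \<in> A 1" "y2 \<in> A 2"
        using x y by blast
      have "x + y = (x0 + y0) + (x1 + y1) + (x2 + y2)" by (simp add: xy(1,2))
      also have "\<dots> \<in> ?T"
        by (intro inT subspace_add[OF subspace_component] xy)
      finally show ?thesis .
    qed
    show "scale c x \<in> ?T" if "x \<in> ?T" for c x
      using that inT subspace_scale[OF subspace_component] by (auto simp: scale_right_distrib)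
  qed
  moreover have "A n \<subseteq> ?T" for n
  proof
    fix x assume x: "x \<in> A n"
    consider "n = 0" | "n = 1" | "n = 2" | "n \<ge> 3" by linarith
    then show "x \<in> ?T"
    proof cases
      case 1 then show ?thesis using inT[of x 0 0] x by simp
    next
      case 2 then show ?thesis using inT[of 0 x 0] x by simp
    next
      case 3 then show ?thesis using inT[of 0 0 x] x by simp
    next
      case 4 then show ?thesis using inT[of 0 0 0] x degree_ge_3 by simp
    qed
  qed
  moreover have "a \<in> direct_sum A" by (simp add: direct_sum_components)
  then obtain f N where a: "a = (\<Sum>n\<in>N. f n)" "\<forall>n\<in>N. f n \<in> A n"
    unfolding direct_sum_def by blast
  ultimately have "a \<in> ?T" unfolding a(1) by (intro subspace_sum) blast+
  then show ?thesis using that by blast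
qed

lemma graded_zero:
  assumes "x0 \<in> A 0" "x1 \<in> A 1" "x2 \<in> A 2" and "x0 + x1 + x2 = 0"
  shows "x0 = 0" and "x1 = 0" and "x2 = 0"
proof -
  define f where "f n = (if n = 0 then x0 else if n = 1 then x1 else x2)" for n :: nat
  have "finite {0, 1, 2::nat}" "\<forall>n\<in>{0, 1, 2}. f n \<in> A n" "(\<Sum>n\<in>{0, 1, 2}. f n) = 0"
    using assms by (simp_all add: f_def add.assoc)
  then have zero: "\<forall>n\<in>{0, 1, 2}. f n = 0"
    using independent_components unfolding independent_family_def by blast
  show "x0 = 0" "x1 = 0" "x2 = 0"
    using bspec[OF zero, of 0] bspec[OF zero, of 1] bspec[OF zero, of 2] by (simp_all add: f_def)
qed

lemma vecs_decomposition:
  assumes "x \<in> vecs r UNIV"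
  obtains x0 x1 x2 where "x0 \<in> vecs r (A 0)" "x1 \<in> vecs r (A 1)" "x2 \<in> vecs r (A 2)"
    "x = x0 + x1 + x2"
proof -
  have "\<forall>a. \<exists>p. fst p \<in> A 0 \<and> fst (snd p) \<in> A 1 \<and> snd (snd p) \<in> A 2 \<and>
      a = fst p + fst (snd p) + snd (snd p)"
  proof
    fix a
    obtain x0 x1 x2 where "x0 \<in> A 0" "x1 \<in> A 1" "x2 \<in> A 2" "a = x0 + x1 + x2"
      using graded_decomposition .
    then show "\<exists>p. fst p \<in> A 0 \<and> fst (snd p) \<in> A 1 \<and> snd (snd p) \<in> A 2 \<and>
        a = fst p + fst (snd p) + snd (snd p)"
      by (intro exI[of _ "(x0, x1, x2)"]) simp
  qed
  then obtain p where p: "\<And>a. fst (p a) \<in> A 0" "\<And>a. fst (snd (p a)) \<in> A 1"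
      "\<And>a. snd (snd (p a)) \<in> A 2" "\<And>a. a = fst (p a) + fst (snd (p a)) + snd (snd (p a))"
    by metis
  have p_0: "fst (p 0) = 0" "fst (snd (p 0)) = 0" "snd (snd (p 0)) = 0"
    using graded_zero[OF p(1-3) p(4)[of 0, symmetric]] by auto
  have lookup_map: "Poly_Mapping.lookup (Poly_Mapping.map g x) i = g (Poly_Mapping.lookup x i)"
    if "g 0 = 0" for g i
    using that by (simp add: Poly_Mapping.map.rep_eq when_def)
  show ?thesis
  proof (rule that)
    let ?x0 = "Poly_Mapping.map (\<lambda>a. fst (p a)) x"
    let ?x1 = "Poly_Mapping.map (\<lambda>a. fst (snd (p a))) x"
    let ?x2 = "Poly_Mapping.map (\<lambda>a. snd (snd (p a))) x"
    show "?x0 \<in> vecs r (A 0)" "?x1 \<in> vecs r (A 1)" "?x2 \<in> vecs r (A 2)"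
      using assms p(1-3) by (auto simp: vecs_def lookup_map p_0)
    show "x = ?x0 + ?x1 + ?x2"
      by (rule poly_mapping_eqI) (simp add: lookup_add lookup_map p_0 p(4)[symmetric])
  qed
qed

lemma vecs_graded_zero:
  assumes "x0 \<in> vecs r (A 0)" "x1 \<in> vecs r (A 1)" "x2 \<in> vecs r (A 2)" and "x0 + x1 + x2 = 0"
  shows "x0 = 0" and "x1 = 0" and "x2 = 0"
proof -
  have "Poly_Mapping.lookup x0 i + Poly_Mapping.lookup x1 i + Poly_Mapping.lookup x2 i = 0" for i
    using assms(4) by (metis lookup_add lookup_zero)
  moreover have "Poly_Mapping.lookup x0 i \<in> A 0" "Poly_Mapping.lookup x1 i \<in> A 1"
    "Poly_Mapping.lookup x2 i \<in> A 2" for i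
    using assms(1-3) by (simp_all add: vecs_def)
  ultimately have "Poly_Mapping.lookup x0 i = 0" "Poly_Mapping.lookup x1 i = 0"
    "Poly_Mapping.lookup x2 i = 0" for i
    by (blast dest: graded_zero)+
  then show "x0 = 0" "x1 = 0" "x2 = 0" by (simp_all add: poly_mapping_eqI)
qed

lemma vecs_degree_ge_3: "n \<ge> 3 \<Longrightarrow> x \<in> vecs r (A n) \<Longrightarrow> x = 0"
  by (auto simp: vecs_def degree_ge_3 intro!: poly_mapping_eqI)

text \<open>
  Degree by degree: coordinates in \<open>A\<^sub>0\<close> produce the span \<open>N\<close> of the basis, coordinates in \<open>A\<^sub>1\<close>
  produce \<open>N A\<^sub>1 = A\<^sub>2\<^sup>s\<close>, and coordinates in \<open>A\<^sub>2\<close> contribute nothing since \<open>A\<^sub>3 = 0\<close>.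
\<close>
lemma comb_image:
  assumes "syzygy_basis s N ys"
  shows "comb ys ` vecs (length ys) UNIV = {x + y | x y. x \<in> N \<and> y \<in> vecs s (A 2)}"
proof -
  have N: "N = comb ys ` vecs (length ys) (A 0)"
    and full: "vecs s (A 2) \<subseteq> comb ys ` vecs (length ys) (A 1)"
    and ys: "set ys \<subseteq> vecs s (A 1)"
    using assms span_set_eq_comb[of ys] products_set_subset_comb[of 1 ys] vec.span_superset[of "set ys"]
    unfolding syzygy_basis_def tame_basis_def by auto
  show ?thesis
  proof (intro equalityI subsetI)
    fix z assume "z \<in> comb ys ` vecs (length ys) UNIV"
    then obtain c where c: "c \<in> vecs (length ys) UNIV" "z = comb ys c" by blast
    obtain c0 c1 c2 where d: "c0 \<in> vecs (length ys) (A 0)" "c1 \<in> vecs (length ys) (A 1)"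
        "c2 \<in> vecs (length ys) (A 2)" "c = c0 + c1 + c2"
      using vecs_decomposition[OF c(1)] .
    have "comb ys c1 \<in> vecs s (A 2)" "comb ys c2 \<in> vecs s (A 3)"
      using comb_vecs[OF ys d(2)] comb_vecs[OF ys d(3)] by (simp_all add: numeral_2_eq_2 numeral_3_eq_3)
    then have "z = comb ys c0 + comb ys c1" "comb ys c1 \<in> vecs s (A 2)"
      using vecs_degree_ge_3[of 3] by (simp_all add: c(2) d(4) comb_add)
    moreover have "comb ys c0 \<in> N" using N d(1) by blast
    ultimately show "z \<in> {x + y | x y. x \<in> N \<and> y \<in> vecs s (A 2)}" by blast
  next
    fix z assume "z \<in> {x + y | x y. x \<in> N \<and> y \<in> vecs s (A 2)}"
    then obtain x y where xy: "z = x + y" "x \<in> N" "y \<in> vecs s (A 2)" by blast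
    obtain c0 where c0: "c0 \<in> vecs (length ys) (A 0)" "x = comb ys c0" using xy(2) N by blast
    obtain c1 where c1: "c1 \<in> vecs (length ys) (A 1)" "y = comb ys c1" using xy(3) full by blast
    have "c0 + c1 \<in> vecs (length ys) UNIV" using c0(1) c1(1) by (auto simp: vecs_def lookup_add)
    then show "z \<in> comb ys ` vecs (length ys) UNIV"
      using xy(1) c0(2) c1(2) by (auto simp: comb_add[symmetric])
  qed
qed

text \<open>
  Linear independence kills the coordinates in \<open>A\<^sub>0\<close>, those in \<open>A\<^sub>1\<close> form a relation by definition, and
  those in \<open>A\<^sub>2\<close> are arbitrary since \<open>A\<^sub>3 = 0\<close>.  This is the image of the next differential, as given by
  \<open>comb_image\<close> for \<^term>\<open>N = relations ys\<close>.
\<close>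
lemma comb_kernel:
  assumes "syzygy_basis s N ys"
  shows "{c \<in> vecs (length ys) UNIV. comb ys c = 0} =
    {x + y | x y. x \<in> relations ys \<and> y \<in> vecs (length ys) (A 2)}"
proof -
  have ys: "set ys \<subseteq> vecs s (A 1)" "distinct ys" "vec.independent (set ys)"
    using assms vec.span_superset[of "set ys"] unfolding syzygy_basis_def tame_basis_def by auto
  have deg3: "comb ys c = 0" if "c \<in> vecs (length ys) (A 2)" for c
    using comb_vecs[OF ys(1) that] vecs_degree_ge_3[of 3] by (simp add: numeral_3_eq_3)
  show ?thesis
  proof (intro equalityI subsetI)
    fix c assume "c \<in> {c \<in> vecs (length ys) UNIV. comb ys c = 0}"
    then have c: "c \<in> vecs (length ys) UNIV" "comb ys c = 0" by auto
    obtain c0 c1 c2 where d: "c0 \<in> vecs (length ys) (A 0)" "c1 \<in> vecs (length ys) (A 1)"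
        "c2 \<in> vecs (length ys) (A 2)" "c = c0 + c1 + c2"
      using vecs_decomposition[OF c(1)] .
    have "comb ys c0 \<in> vecs s (A 1)" "comb ys c1 \<in> vecs s (A 2)"
      using comb_vecs[OF ys(1) d(1)] comb_vecs[OF ys(1) d(2)] by (simp_all add: numeral_2_eq_2)
    moreover have "0 + comb ys c0 + comb ys c1 = 0"
      using c(2) d(4) deg3[OF d(3)] by (simp add: comb_add)
    moreover have "0 \<in> vecs s (A 0)" by (simp add: vecs_def)
    ultimately have zero: "comb ys c0 = 0" "comb ys c1 = 0"
      using vecs_graded_zero[of 0 s "comb ys c0" "comb ys c1"] by simp_all
    then have "c0 = 0" using comb_injective_on_scalars[OF ys(2,3) d(1)] by blast
    then have "c = c1 + c2" "c1 \<in> relations ys" using d zero(2) by (simp_all add: relations_def)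
    then show "c \<in> {x + y | x y. x \<in> relations ys \<and> y \<in> vecs (length ys) (A 2)}"
      using d(3) by blast
  next
    fix c assume "c \<in> {x + y | x y. x \<in> relations ys \<and> y \<in> vecs (length ys) (A 2)}"
    then show "c \<in> {c \<in> vecs (length ys) UNIV. comb ys c = 0}"
      using deg3 by (auto simp: relations_def comb_add vecs_def lookup_add)
  qed
qed

section \<open>Free modules of finite rank and the augmentation\<close>

text \<open>
  The free module \<open>A(-n)\<^sup>r\<close>, whose unit vectors have degree \<open>n\<close>.
\<close>
definition free_module :: "nat \<Rightarrow> nat \<Rightarrow> ('a, nat \<Rightarrow>\<^sub>0 'a) gr_module"
  where "free_module n r =
    \<lparr>act = ract, component = (\<lambda>k. if n \<le> k then vecs r (A (k - n)) else {0})\<rparr>"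

lemma act_free_module [simp]: "act (free_module n r) = ract"
  by (simp add: free_module_def)

lemma component_free_module:
  "component (free_module n r) k = (if n \<le> k then vecs r (A (k - n)) else {0})"
  by (simp add: free_module_def)

lemma subspace_component_free_module: "vec.subspace (component (free_module n r) k)"
  by (simp add: component_free_module subspace_vecs subspace_component)

lemma elements_free_module: "elements (free_module n r) = vecs r UNIV"
proof (intro equalityI subsetI)
  fix x assume "x \<in> elements (free_module n r)"
  then obtain f N where x: "x = (\<Sum>k\<in>N. f k)" "\<forall>k\<in>N. f k \<in> component (free_module n r) k"
    unfolding direct_sum_def by blast
  have "component (free_module n r) k \<subseteq> vecs r UNIV" for k
    by (auto simp: component_free_module vecs_def)
  then show "x \<in> vecs r UNIV"
    unfolding x(1) using x(2) by (intro vec.subspace_sum subspace_vecs subspace_UNIV) blast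
next
  fix x assume "x \<in> vecs r UNIV"
  then obtain x0 x1 x2 where x: "x0 \<in> vecs r (A 0)" "x1 \<in> vecs r (A 1)" "x2 \<in> vecs r (A 2)"
    "x = x0 + x1 + x2"
    using vecs_decomposition by blast
  define f where "f k = (if k = n then x0 else if k = n + 1 then x1 else x2)" for k
  have "x = (\<Sum>k\<in>{n, n + 1, n + 2}. f k)" by (simp add: f_def x(4) add.assoc)
  moreover have "\<forall>k\<in>{n, n + 1, n + 2}. f k \<in> component (free_module n r) k"
    using x(1-3) by (simp add: f_def component_free_module)
  ultimately show "x \<in> elements (free_module n r)"
    unfolding direct_sum_def by blast
qed

text \<open>
  A vanishing sum of homogeneous vectors vanishes in each coordinate, where the components of \<open>A\<close>
  are independent after the shift of degrees by \<open>n\<close>.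
\<close>
lemma independent_components_free_module: "independent_family (component (free_module n r))"
  unfolding independent_family_def
proof (intro allI impI ballI)
  fix f N k
  assume N: "finite N" and f: "\<forall>k\<in>N. f k \<in> component (free_module n r) k"
    and sum: "(\<Sum>k\<in>N. f k) = 0" and k: "k \<in> N"
  show "f k = 0"
  proof (cases "n \<le> k")
    case False
    then show ?thesis using f k by (auto simp: component_free_module)
  next
    case True
    let ?N = "{m. m + n \<in> N}"
    have "Poly_Mapping.lookup (f k) i = 0" for i
    proof -
      define g where "g m = Poly_Mapping.lookup (f (m + n)) i" for m
      have fin: "finite ?N"
        using N by (rule finite_vimageI[of N "\<lambda>m. m + n", unfolded vimage_def]) simp
      have "(\<Sum>m\<in>?N. g m) = (\<Sum>k\<in>(\<lambda>m. m + n) ` ?N. Poly_Mapping.lookup (f k) i)"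
        by (simp add: sum.reindex g_def)
      also have "\<dots> = (\<Sum>k\<in>N. Poly_Mapping.lookup (f k) i)"
      proof (intro sum.mono_neutral_left N ballI)
        fix k assume "k \<in> N - (\<lambda>m. m + n) ` ?N"
        then have "\<not> n \<le> k" "k \<in> N" by (auto simp: image_iff) (metis le_add_diff_inverse2)
        then show "Poly_Mapping.lookup (f k) i = 0" using f by (auto simp: component_free_module)
      qed auto
      also have "\<dots> = 0" using sum by (metis lookup_sum lookup_zero)
      finally have "(\<Sum>m\<in>?N. g m) = 0" .
      moreover have "\<forall>m\<in>?N. g m \<in> A m"
        using f by (auto simp: g_def component_free_module vecs_def)
      ultimately have "\<forall>m\<in>?N. g m = 0"
        using independent_components fin unfolding independent_family_def by blast
      then have "g (k - n) = 0" using k True by simp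
      then show ?thesis using True by (simp add: g_def)
    qed
    then show ?thesis by (simp add: poly_mapping_eqI)
  qed
qed

lemma graded_right_module_free_module: "graded_right_module (free_module n r)"
  unfolding graded_right_module_def elements_free_module act_free_module
proof (intro conjI allI ballI)
  show "0 \<in> component (free_module n r) k" for k
    by (rule vec.subspace_0[OF subspace_component_free_module])
  show "x - y \<in> component (free_module n r) k"
    if "x \<in> component (free_module n r) k" "y \<in> component (free_module n r) k" for k x y
    using that by (rule vec.subspace_diff[OF subspace_component_free_module])
  show "ract x a \<in> component (free_module n r) (i + j)"
    if "x \<in> component (free_module n r) i" "a \<in> A j" for i j x a
  proof (cases "n \<le> i")
    case True
    then show ?thesis
      using that ract_vecs[of x r "i - n" a j] by (simp add: component_free_module)
  next
    case False
    then show ?thesis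
      using that vec.subspace_0[OF subspace_component_free_module]
      by (simp add: component_free_module[of n r i] ract_zero_left)
  qed
qed (simp_all add: independent_components_free_module ract_add_left ract_add_right ract_mult ract_one)

lemma vecs_expansion:
  assumes "x \<in> vecs r UNIV"
  shows "x = (\<Sum>i<r. ract (Poly_Mapping.single i 1) (Poly_Mapping.lookup x i))"
  using poly_mapping_eq_sum_single[OF finite_lessThan vecs_keys[OF assms]]
  by (simp add: ract_single)

lemma inj_unit_vector: "inj (\<lambda>i::nat. Poly_Mapping.single i (1::'a))"
  by (rule injI) (metis lookup_single_eq lookup_single_not_eq one_neq_zero)

lemma unit_vector_in_component: "i < r \<Longrightarrow> Poly_Mapping.single i 1 \<in> component (free_module n r) n"
  by (simp add: component_free_module single_in_vecs one_in_A0)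

lemma free_graded_free_module: "free_graded (free_module n r)"
  unfolding free_graded_def elements_free_module act_free_module
proof (intro exI conjI ballI)
  let ?e = "\<lambda>i. Poly_Mapping.single i (1::'a)"
  let ?B = "?e ` {..<r}"
  show "?B \<subseteq> (\<Union>k. component (free_module n r) k)"
    using unit_vector_in_component[of _ r n] by blast
  fix x assume x: "x \<in> vecs r UNIV"
  have expand: "(\<Sum>b\<in>Poly_Mapping.keys f. ract b (Poly_Mapping.lookup f b)) =
      (\<Sum>i<r. Poly_Mapping.single i (Poly_Mapping.lookup f (?e i)))"
    if "Poly_Mapping.keys f \<subseteq> ?B" for f :: "(nat \<Rightarrow>\<^sub>0 'a) \<Rightarrow>\<^sub>0 'a"
  proof -
    have "(\<Sum>b\<in>Poly_Mapping.keys f. ract b (Poly_Mapping.lookup f b)) =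
        (\<Sum>b\<in>?B. ract b (Poly_Mapping.lookup f b))"
      using that by (intro sum.mono_neutral_left) (auto simp: ract_zero_right in_keys_iff)
    also have "\<dots> = (\<Sum>i<r. ract (?e i) (Poly_Mapping.lookup f (?e i)))"
      by (subst sum.reindex) (auto intro: inj_on_subset[OF inj_unit_vector])
    finally show ?thesis by (simp add: ract_single)
  qed
  have coordinate: "Poly_Mapping.lookup (\<Sum>i<r. Poly_Mapping.single i (h i)) j = h j"
    if "j < r" for j and h :: "nat \<Rightarrow> 'a"
    using that by (simp add: lookup_sum lookup_single when_def sum.delta)
  define f where "f = (\<Sum>i<r. Poly_Mapping.single (?e i) (Poly_Mapping.lookup x i))"
  have lookup_f: "Poly_Mapping.lookup f b = (\<Sum>i<r. Poly_Mapping.lookup x i when ?e i = b)" for b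
    by (simp add: f_def lookup_sum lookup_single)
  show "\<exists>!f. Poly_Mapping.keys f \<subseteq> ?B \<and>
      x = (\<Sum>b\<in>Poly_Mapping.keys f. ract b (Poly_Mapping.lookup f b))"
  proof (rule ex1I[of _ f])
    have keys: "Poly_Mapping.keys f \<subseteq> ?B"
    proof
      fix b assume "b \<in> Poly_Mapping.keys f"
      then have "(\<Sum>i<r. Poly_Mapping.lookup x i when ?e i = b) \<noteq> 0"
        by (simp add: in_keys_iff lookup_f)
      then obtain i where "i < r" "(Poly_Mapping.lookup x i when ?e i = b) \<noteq> 0"
        by (meson lessThan_iff sum.not_neutral_contains_not_neutral)
      then show "b \<in> ?B" by (auto simp: when_def split: if_splits)
    qed
    have "Poly_Mapping.lookup f (?e j) = Poly_Mapping.lookup x j" if "j < r" for j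
      using that by (simp add: lookup_f inj_eq[OF inj_unit_vector] when_def sum.delta)
    then have "(\<Sum>i<r. Poly_Mapping.single i (Poly_Mapping.lookup f (?e i))) = x"
      using poly_mapping_eq_sum_single[OF finite_lessThan vecs_keys[OF x]] by simp
    then show "Poly_Mapping.keys f \<subseteq> ?B \<and>
        x = (\<Sum>b\<in>Poly_Mapping.keys f. ract b (Poly_Mapping.lookup f b))"
      using keys expand[OF keys] by simp
    fix g assume g: "Poly_Mapping.keys g \<subseteq> ?B \<and>
        x = (\<Sum>b\<in>Poly_Mapping.keys g. ract b (Poly_Mapping.lookup g b))"
    show "g = f"
    proof (rule poly_mapping_eqI)
      fix b
      show "Poly_Mapping.lookup g b = Poly_Mapping.lookup f b"
      proof (cases "b \<in> ?B")
        case True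
        then obtain j where j: "j < r" "b = ?e j" by blast
        have "x = (\<Sum>i<r. Poly_Mapping.single i (Poly_Mapping.lookup g (?e i)))"
          using g expand[of g] by simp
        then have "Poly_Mapping.lookup x j = Poly_Mapping.lookup g (?e j)"
          using coordinate[OF j(1), of "\<lambda>i. Poly_Mapping.lookup g (?e i)"] by simp
        then show ?thesis
          using j by (simp add: lookup_f inj_eq[OF inj_unit_vector] when_def sum.delta)
      next
        case False
        then show ?thesis using g keys by (metis in_keys_iff subsetD)
      qed
    qed
  qed
qed

lemma finite_dim_component_free_module: "finite_dim_component (free_module n r) n"
  unfolding finite_dim_component_def act_free_module
proof (intro exI[of _ "(\<lambda>i. Poly_Mapping.single i 1) ` {..<r}"] conjI ballI)
  let ?e = "\<lambda>i. Poly_Mapping.single i (1::'a)"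
  show "?e ` {..<r} \<subseteq> component (free_module n r) n"
    using unit_vector_in_component by blast
  show "finite (?e ` {..<r})" by simp
  fix x assume "x \<in> component (free_module n r) n"
  then have x: "x \<in> vecs r (A 0)" by (simp add: component_free_module)
  then have "\<forall>i. \<exists>c. Poly_Mapping.lookup x i = scale c 1"
    unfolding vecs_def connected by auto
  then obtain c where c: "\<And>i. Poly_Mapping.lookup x i = scale (c i) 1" by metis
  have "x = (\<Sum>i<r. ract (?e i) (Poly_Mapping.lookup x i))"
    using x by (intro vecs_expansion) (simp add: vecs_def)
  also have "\<dots> = (\<Sum>i<r. ract (?e i) (scale (c (inv_into UNIV ?e (?e i))) 1))"
    by (simp add: c inv_f_f[OF inj_unit_vector])
  also have "\<dots> = (\<Sum>s\<in>?e ` {..<r}. ract s (scale (c (inv_into UNIV ?e s)) 1))"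
    by (subst sum.reindex) (auto intro: inj_on_subset[OF inj_unit_vector])
  finally show "\<exists>c. x = (\<Sum>s\<in>?e ` {..<r}. ract s (scale (c s) 1))"
    by (rule exI[of _ "\<lambda>s. c (inv_into UNIV ?e s)"])
qed

lemma free_module_generated:
  "submodule (free_module n r) hull component (free_module n r) n = elements (free_module n r)"
proof (rule equalityI)
  have "submodule (free_module n r) (elements (free_module n r))"
    by (auto simp: submodule_def elements_free_module vecs_def lookup_add)
  then show "submodule (free_module n r) hull component (free_module n r) n
      \<subseteq> elements (free_module n r)"
    by (intro hull_minimal) (auto simp: elements_free_module component_free_module vecs_def)
  show "elements (free_module n r) \<subseteq> submodule (free_module n r) hull component (free_module n r) n"
    unfolding hull_def
  proof (intro subsetI InterI)
    fix x T assume "x \<in> elements (free_module n r)"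
      and "T \<in> {T. submodule (free_module n r) T \<and> component (free_module n r) n \<subseteq> T}"
    then have x: "x \<in> vecs r UNIV" and T: "submodule (free_module n r) T"
      "component (free_module n r) n \<subseteq> T"
      by (simp_all add: elements_free_module)
    have "(\<Sum>i\<in>I. ract (Poly_Mapping.single i 1) (Poly_Mapping.lookup x i)) \<in> T"
      if "finite I" "I \<subseteq> {..<r}" for I
      using that
    proof (induction I rule: finite_induct)
      case empty
      then show ?case using T(1) by (simp add: submodule_def)
    next
      case (insert i I)
      then have "Poly_Mapping.single i 1 \<in> T" using T(2) unit_vector_in_component by blast
      then show ?case using insert T(1) by (simp add: submodule_def)
    qed
    from this[of "{..<r}"] show "x \<in> T" using vecs_expansion[OF x] by simp
  qed
qed

text \<open>
  The augmentation is a definite description; this lemma shows that the scalar it describes is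
  unique, and thereby makes it computable.  All its other properties are read off from here.
\<close>
lemma augmentation_eq:
  assumes "x1 \<in> A 1" "x2 \<in> A 2"
  shows "augmentation (scale c 1 + x1 + x2) = c"
proof -
  let ?C = "\<lambda>n. if n = 0 then {0} else A n"
  let ?J = "{y1 + y2 | y1 y2. y1 \<in> A 1 \<and> y2 \<in> A 2}"
  have inJ: "y1 + y2 \<in> ?J" if "y1 \<in> A 1" "y2 \<in> A 2" for y1 y2 using that by blast
  have J: "direct_sum ?C \<subseteq> ?J"
  proof
    fix x assume "x \<in> direct_sum ?C"
    then obtain f N where x: "x = (\<Sum>n\<in>N. f n)" "\<forall>n\<in>N. f n \<in> ?C n"
      unfolding direct_sum_def by blast
    have "subspace ?J"
      unfolding subspace_def
    proof (intro conjI ballI allI)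
      show "0 \<in> ?J" using inJ[of 0 0] by simp
      show "a + b \<in> ?J" if a: "a \<in> ?J" and b: "b \<in> ?J" for a b
      proof -
        obtain a1 a2 b1 b2 where ab: "a = a1 + a2" "b = b1 + b2"
          "a1 \<in> A 1" "a2 \<in> A 2" "b1 \<in> A 1" "b2 \<in> A 2"
          using a b by blast
        have "a + b = (a1 + b1) + (a2 + b2)" by (simp add: ab(1,2))
        also have "\<dots> \<in> ?J" by (intro inJ subspace_add[OF subspace_component] ab)
        finally show ?thesis .
      qed
      show "scale c a \<in> ?J" if "a \<in> ?J" for c a
        using that inJ subspace_scale[OF subspace_component] by (auto simp: scale_right_distrib)
    qed
    moreover have "f n \<in> ?J" if "n \<in> N" for n
    proof -
      have fn: "f n \<in> ?C n" using x(2) that by blast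
      consider "n = 0" | "n = 1" | "n = 2" | "n \<ge> 3" by linarith
      then show ?thesis
      proof cases
        case 1 then show ?thesis using inJ[of 0 0] fn by simp
      next
        case 2 then show ?thesis using inJ[of "f n" 0] fn by simp
      next
        case 3 then show ?thesis using inJ[of 0 "f n"] fn by simp
      next
        case 4 then show ?thesis using inJ[of 0 0] fn degree_ge_3 by simp
      qed
    qed
    ultimately show "x \<in> ?J" unfolding x(1) by (intro subspace_sum)
  qed
  show ?thesis
    unfolding augmentation_def
  proof (rule the_equality)
    define f where "f n = (if n = 1 then x1 else x2)" for n :: nat
    have "x1 + x2 = (\<Sum>n\<in>{1, 2}. f n)" "\<forall>n\<in>{1, 2}. f n \<in> ?C n"
      using assms by (simp_all add: f_def)
    then have "x1 + x2 \<in> direct_sum ?C" unfolding direct_sum_def by blast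
    then show "scale c 1 + x1 + x2 - scale c 1 \<in> direct_sum ?C" by (simp add: add.assoc)
  next
    fix c' assume "scale c 1 + x1 + x2 - scale c' 1 \<in> direct_sum ?C"
    then obtain y1 y2 where y: "y1 \<in> A 1" "y2 \<in> A 2"
      "scale c 1 + x1 + x2 - scale c' 1 = y1 + y2"
      using J by blast
    have "scale (c - c') 1 + (x1 - y1) + (x2 - y2) = 0"
      using y(3) by (simp add: scale_left_diff_distrib algebra_simps)
    moreover have "scale (c - c') 1 \<in> A 0" unfolding connected by blast
    ultimately have "scale (c - c') 1 = 0"
      using graded_zero(1) subspace_diff[OF subspace_component assms(1) y(1)]
        subspace_diff[OF subspace_component assms(2) y(2)] by blast
    then show "c' = c" by simp
  qed
qed

lemma augmentation_decomposition:
  obtains x1 x2 where "x1 \<in> A 1" "x2 \<in> A 2" "a = scale (augmentation a) 1 + x1 + x2"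
proof -
  obtain x0 x1 x2 where x: "x0 \<in> A 0" "x1 \<in> A 1" "x2 \<in> A 2" "a = x0 + x1 + x2"
    using graded_decomposition .
  moreover obtain c where "x0 = scale c 1" using x(1) unfolding connected by blast
  ultimately show ?thesis using augmentation_eq[of x1 x2 c] by (intro that[of x1 x2]) simp_all
qed

lemma augmentation_add: "augmentation (a + b) = augmentation a + augmentation b"
proof -
  obtain x1 x2 where x: "x1 \<in> A 1" "x2 \<in> A 2" "a = scale (augmentation a) 1 + x1 + x2"
    using augmentation_decomposition .
  obtain y1 y2 where y: "y1 \<in> A 1" "y2 \<in> A 2" "b = scale (augmentation b) 1 + y1 + y2"
    using augmentation_decomposition .
  have "a + b = scale (augmentation a + augmentation b) 1 + (x1 + y1) + (x2 + y2)"
    by (subst x(3), subst y(3)) (simp add: scale_left_distrib)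
  then show ?thesis
    using augmentation_eq[OF subspace_add[OF subspace_component x(1) y(1)]
        subspace_add[OF subspace_component x(2) y(2)]] by simp
qed

lemma augmentation_mult: "augmentation (a * b) = augmentation a * augmentation b"
proof -
  obtain x1 x2 where x: "x1 \<in> A 1" "x2 \<in> A 2" "a = scale (augmentation a) 1 + x1 + x2"
    using augmentation_decomposition .
  obtain y1 y2 where y: "y1 \<in> A 1" "y2 \<in> A 2" "b = scale (augmentation b) 1 + y1 + y2"
    using augmentation_decomposition .
  let ?p = "augmentation a" and ?q = "augmentation b"
  have m: "x1 * y1 \<in> A 2" "x1 * y2 = 0" "x2 * y1 = 0" "x2 * y2 = 0"
    using mult_component[OF x(1) y(1)] mult_component[OF x(1) y(2)] mult_component[OF x(2) y(1)]
      mult_component[OF x(2) y(2)] degree_ge_3[of 3] degree_ge_3[of 4]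
    by (simp_all add: numeral_2_eq_2 numeral_3_eq_3 eval_nat_numeral)
  have "a * b = (scale ?p 1 + x1 + x2) * (scale ?q 1 + y1 + y2)"
    using x(3) y(3) by simp
  also have "\<dots> = scale (?p * ?q) 1 + (scale ?q x1 + scale ?p y1) + (scale ?q x2 + scale ?p y2 + x1 * y1)"
    using m(2-4) by (simp add: distrib_left distrib_right scale_right_distrib
        scale_mult_left[symmetric] scale_mult_right[symmetric] mult.commute)
  finally show ?thesis
    using augmentation_eq[of "scale ?q x1 + scale ?p y1" "scale ?q x2 + scale ?p y2 + x1 * y1" "?p * ?q"]
    using m(1) x(1,2) y(1,2) subspace_add[OF subspace_component] subspace_scale[OF subspace_component]
    by simp
qed

lemma augmentation_kernel: "augmentation a = 0 \<longleftrightarrow> (\<exists>x1\<in>A 1. \<exists>x2\<in>A 2. a = x1 + x2)"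
proof
  assume "augmentation a = 0"
  moreover obtain x1 x2 where "x1 \<in> A 1" "x2 \<in> A 2" "a = scale (augmentation a) 1 + x1 + x2"
    using augmentation_decomposition .
  ultimately show "\<exists>x1\<in>A 1. \<exists>x2\<in>A 2. a = x1 + x2" by auto
next
  assume "\<exists>x1\<in>A 1. \<exists>x2\<in>A 2. a = x1 + x2"
  then show "augmentation a = 0" using augmentation_eq[of _ _ 0] by force
qed

lemma elements_trivial_module: "elements trivial_module = UNIV"
proof -
  have "c \<in> elements trivial_module" for c :: 'k
    unfolding direct_sum_def trivial_module_def
    by (rule CollectI, rule exI[of _ "\<lambda>_. c"], rule exI[of _ "{0}"]) simp
  then show ?thesis by blast
qed

lemma graded_hom_augmentation:
  "graded_hom (free_module 0 1) trivial_module (\<lambda>x. augmentation (Poly_Mapping.lookup x 0))"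
  unfolding graded_hom_def
proof (intro conjI ballI allI)
  fix k
  show "(\<lambda>x. augmentation (Poly_Mapping.lookup x 0)) ` component (free_module 0 1) k
      \<subseteq> component trivial_module k"
  proof (cases "k = 0")
    case True
    then show ?thesis by (simp add: trivial_module_def)
  next
    case False
    have "augmentation a = 0" if "a \<in> A k" for a
    proof -
      consider "k = 1" | "k = 2" | "k \<ge> 3" using False by linarith
      then show ?thesis
      proof cases
        case 1
        then show ?thesis
          using that zero_mem[of 2] augmentation_kernel[of a] by (metis add.right_neutral)
      next
        case 2
        then show ?thesis
          using that zero_mem[of 1] augmentation_kernel[of a] by (metis add.left_neutral)
      next
        case 3
        then have "a = 0 + 0" using that degree_ge_3 by simp
        then show ?thesis using zero_mem augmentation_kernel[of a] by blast
      qed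
    qed
    then show ?thesis using False by (auto simp: trivial_module_def component_free_module vecs_def)
  qed
qed (simp_all add: lookup_add augmentation_add augmentation_mult trivial_module_def)

lemma graded_hom_comb:
  assumes "syzygy_basis s N ys"
  shows "graded_hom (free_module (Suc n) (length ys)) (free_module n s) (comb ys)"
  unfolding graded_hom_def
proof (intro conjI ballI allI)
  fix k
  have ys: "set ys \<subseteq> vecs s (A 1)"
    using assms vec.span_superset[of "set ys"] unfolding syzygy_basis_def tame_basis_def by auto
  show "comb ys ` component (free_module (Suc n) (length ys)) k \<subseteq> component (free_module n s) k"
  proof (cases "Suc n \<le> k")
    case True
    then have "1 + (k - Suc n) = k - n" by simp
    then show ?thesis
      using True comb_vecs[OF ys, of _ "length ys" "k - Suc n"]
      by (auto simp: component_free_module)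
  next
    case False
    then show ?thesis
      using vec.subspace_0[OF subspace_component_free_module, of n s k]
      by (auto simp: component_free_module[of "Suc n"])
  qed
qed (simp_all add: comb_add comb_ract)

text \<open>
  Exactness at each term compares two descriptions of the same subspace: the kernel from
  \<open>comb_kernel\<close> (for the first term, the vectors in \<open>A\<^sub>1 \<oplus> A\<^sub>2\<close>) with the image from \<open>comb_image\<close>.
\<close>
lemma koszul_if_split: koszul
proof -
  obtain X where X0: "syzygy_basis 1 (vecs 1 (A 1)) (X 0)"
    and X: "\<And>n. syzygy_basis (length (X n)) (relations (X n)) (X (Suc n))"
    using syzygy_bases_exist by blast
  define r where "r n = (case n of 0 \<Rightarrow> 1 | Suc m \<Rightarrow> length (X m))" for n
  let ?P = "\<lambda>n. free_module n (r n)"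
  let ?\<epsilon> = "\<lambda>x. augmentation (Poly_Mapping.lookup x 0)"
  have basis: "\<exists>N. syzygy_basis (r n) N (X n)" for n
    using X0 X by (cases n) (auto simp: r_def)
  have hom: "graded_hom (?P (Suc n)) (?P n) (comb (X n))" for n
    using basis[of n] graded_hom_comb by (auto simp: r_def)
  have "?\<epsilon> ` elements (?P 0) = elements trivial_module"
  proof -
    have "c \<in> ?\<epsilon> ` elements (?P 0)" for c
    proof (rule image_eqI)
      show "c = ?\<epsilon> (Poly_Mapping.single 0 (scale c 1))"
        using augmentation_eq[of 0 0 c] by simp
      show "Poly_Mapping.single 0 (scale c 1) \<in> elements (?P 0)"
        by (simp add: elements_free_module r_def single_in_vecs)
    qed
    then show ?thesis by (auto simp: elements_trivial_module)
  qed
  moreover have "{x \<in> elements (?P 0). ?\<epsilon> x = 0} = comb (X 0) ` elements (?P 1)"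
  proof -
    have "{x \<in> vecs 1 UNIV. ?\<epsilon> x = 0} = {x + y | x y. x \<in> vecs 1 (A 1) \<and> y \<in> vecs 1 (A 2)}"
    proof (intro equalityI subsetI)
      fix x assume "x \<in> {x \<in> vecs 1 UNIV. ?\<epsilon> x = 0}"
      then obtain x1 x2 where "x \<in> vecs 1 UNIV" "x1 \<in> A 1" "x2 \<in> A 2"
        "Poly_Mapping.lookup x 0 = x1 + x2"
        by (auto simp: augmentation_kernel)
      moreover from this have "x = Poly_Mapping.single 0 x1 + Poly_Mapping.single 0 x2"
        by (intro poly_mapping_eqI) (auto simp: lookup_add lookup_single when_def vecs_def)
      ultimately show "x \<in> {x + y | x y. x \<in> vecs 1 (A 1) \<and> y \<in> vecs 1 (A 2)}"
        using single_in_vecs[of 0 1 _ "A _"] by auto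
    next
      fix x assume "x \<in> {x + y | x y. x \<in> vecs 1 (A 1) \<and> y \<in> vecs 1 (A 2)}"
      then obtain y z where yz: "x = y + z" "y \<in> vecs 1 (A 1)" "z \<in> vecs 1 (A 2)" by blast
      have "Poly_Mapping.lookup y 0 \<in> A 1" "Poly_Mapping.lookup z 0 \<in> A 2"
        using yz(2,3) by (simp_all add: vecs_def)
      then have "?\<epsilon> x = 0"
        unfolding augmentation_kernel yz(1) lookup_add by blast
      then show "x \<in> {x \<in> vecs 1 UNIV. ?\<epsilon> x = 0}"
        using yz by (simp add: vecs_def lookup_add)
    qed
    then show ?thesis
      using comb_image[OF X0] by (simp add: elements_free_module r_def)
  qed
  moreover have "{x \<in> elements (?P (Suc n)). comb (X n) x = 0} =
      comb (X (Suc n)) ` elements (?P (Suc (Suc n)))" for n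
  proof -
    obtain N where "syzygy_basis (r n) N (X n)" using basis by blast
    then show ?thesis
      using comb_kernel comb_image[OF X, of n] by (simp add: elements_free_module r_def)
  qed
  moreover have "graded_hom (?P 0) trivial_module ?\<epsilon>"
    using graded_hom_augmentation by (simp add: r_def)
  ultimately show ?thesis
    unfolding koszul_def
    using graded_right_module_free_module free_graded_free_module
      finite_dim_component_free_module free_module_generated hom
    by (intro exI[of _ ?P] exI[of _ "\<lambda>n. comb (X n)"] exI[of _ ?\<epsilon>] conjI allI)
qed

end


section \<open>The Koszul property from a square-zero summand\<close>

context graded_algebra
begin

text \<open>
  A triple product satisfies \<open>(A\<^sub>1 A\<^sub>1) A\<^sub>1 \<subseteq> A\<^sub>2 A\<^sub>1 = (U A\<^sub>1) A\<^sub>1 \<subseteq> U A\<^sub>2 = U (U A\<^sub>1) = 0\<close>, and in degree \<open>n \<ge> 3\<close>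
  every product of \<open>n\<close> elements of \<open>A\<^sub>1\<close> begins with such a triple.
\<close>
lemma degree_ge_3_vanishes:
  assumes generated: "\<And>n. A n \<subseteq> span {prod_list vs | vs. set vs \<subseteq> A 1 \<and> length vs = n}"
    and U: "U \<subseteq> A 1" and UU: "\<And>u u'. u \<in> U \<Longrightarrow> u' \<in> U \<Longrightarrow> u * u' = 0"
    and UV: "A 2 = span {u * v | u v. u \<in> U \<and> v \<in> A 1}"
    and n: "n \<ge> 3"
  shows "A n = {0}"
proof -
  have kill: "u * b = 0" if u: "u \<in> U" and b: "b \<in> A 2" for u b
    using b unfolding UV
  proof (induction b rule: span_induct_alt)
    case base
    show ?case by simp
  next
    case (step c x y)
    then obtain u' v where "x = u' * v" "u' \<in> U" by blast
    then have "u * x = 0" using UU[OF u] by (simp add: mult.assoc[symmetric])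
    then show ?case using step by (simp add: distrib_left scale_mult_right[symmetric])
  qed
  have triple: "b * v = 0" if b: "b \<in> A 2" and v: "v \<in> A 1" for b v
    using b unfolding UV
  proof (induction b rule: span_induct_alt)
    case base
    show ?case by simp
  next
    case (step c x y)
    then obtain u v' where x: "x = u * v'" "u \<in> U" "v' \<in> A 1" by blast
    have "v' * v \<in> A 2" using mult_component[OF x(3) v] by (simp add: numeral_2_eq_2)
    then have "x * v = 0" using kill[OF x(2)] by (simp add: x(1) mult.assoc)
    then show ?case using step by (simp add: distrib_right scale_mult_left[symmetric])
  qed
  have "prod_list vs = 0" if vs: "set vs \<subseteq> A 1" "length vs = n" for vs
  proof -
    obtain a b c ws where ws: "vs = a # b # c # ws"
      using vs(2) n by (cases vs; cases "tl vs"; cases "tl (tl vs)") auto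
    have "a * b \<in> A 2" using mult_component[of a 1 b 1] vs(1) ws by (simp add: numeral_2_eq_2)
    then have "a * b * c = 0" using triple vs(1) ws by simp
    then show ?thesis by (simp add: ws mult.assoc[symmetric])
  qed
  then have "{prod_list vs | vs. set vs \<subseteq> A 1 \<and> length vs = n} \<subseteq> {0}" by blast
  then have "A n \<subseteq> {0}"
    using generated[of n] span_minimal[of _ "{0}"] subspace_single_0 by blast
  then show ?thesis using zero_mem[of n] by blast
qed

end

theorem theorem1p6:
  fixes scale :: "'k::field \<Rightarrow> 'a::ring_1 \<Rightarrow> 'a"
    and A :: "nat \<Rightarrow> 'a set"
    and U W :: "'a set"
  assumes "graded_algebra scale A"
    and "graded_algebra.quadratic scale A"
    and "module.subspace scale U" and "module.subspace scale W"
    and "A 1 = {u + w | u w. u \<in> U \<and> w \<in> W}" and "U \<inter> W = {0}"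
    and "module.span scale {u * w | u w. u \<in> U \<and> w \<in> W} = A 2"
    and "module.span scale {u * u' | u u'. u \<in> U \<and> u' \<in> U} = {0}"
  shows "graded_algebra.koszul scale A"
proof -
  interpret graded_algebra scale A by fact
  have zero: "0 \<in> U" "0 \<in> W" using assms(6) by auto
  have U: "U \<subseteq> A 1" and W: "W \<subseteq> A 1"
    unfolding assms(5) using zero by force+
  have UU: "u * u' = 0" if "u \<in> U" "u' \<in> U" for u u'
  proof -
    have "u * u' \<in> span {u * u' | u u'. u \<in> U \<and> u' \<in> U}"
      using that by (intro span_base) blast
    then show ?thesis using assms(8) by simp
  qed
  have UV: "A 2 = span {u * v | u v. u \<in> U \<and> v \<in> A 1}"
  proof (rule equalityI)
    show "A 2 \<subseteq> span {u * v | u v. u \<in> U \<and> v \<in> A 1}"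
      unfolding assms(7)[symmetric] using W by (intro span_mono) blast
    have "u * v \<in> A 2" if "u \<in> U" "v \<in> A 1" for u v
      using mult_component[of u 1 v 1] that U by (auto simp: numeral_2_eq_2)
    then show "span {u * v | u v. u \<in> U \<and> v \<in> A 1} \<subseteq> A 2"
      by (intro span_minimal subspace_component) blast
  qed
  interpret split_algebra scale A U
  proof
    show "A n = {0}" if "n \<ge> 3" for n
      using quadratic_generated_in_degree_one[OF assms(2)] U UU UV that
      by (rule degree_ge_3_vanishes)
  qed (fact assms(3) U UU UV)+
  show ?thesis by (rule koszul_if_split)
qed

end
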